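(* There is an absolute constant $C>0$ such that the following holds. Let $r>0$ and let $S$ be a set of $n\ge 1$ points (sites) in $\mathbb{H}^2$ with pairwise hyperbolic distance at least $2r$. Then the Delaunay complex $\mathcal{D}(S)$ is $k$-outerplanar for some $k\le 1+C\,\frac{\log n}{r}$.
   Context: $\mathbb{H}^2$ is the hyperbolic plane of curvature $-1$ with distance $d$, viewed in the Poincaré disk model. For a finite set $S\subset\mathbb{H}^2$, the Voronoi cell of $s\in S$ is the set of points of $\mathbb{H}^2$ closer to $s$ than to any other site; Voronoi edges are the maximal non-degenerate segments of bisectors lying on the common boundary of two cells. The Delaunay complex $\mathcal{D}(S)$ is the plane graph with vertex set $S$ in which $s_1,s_2$ are adjacent iff their Voronoi cells share a Voronoi edge; each such edge is drawn as the two hyperbolic segments from $s_1$ and $s_2$ to a common point in the relative interior of the shared Voronoi edge (this drawing is planar). Its bounded (inner) faces correspond to Voronoi vertices, and it has one unbounded (outer) face; a site lies on the outer face iff its Voronoi cell is unbounded. A plane graph is $1$-outerplanar if all its vertices lie on the outer face, and $k$-outerplanar if deleting all vertices on the outer face (with their incident edges) yields a $(k-1)$-outerplanar graph. *)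

theory Defs
  imports "HOL-Analysis.Analysis"
begin

text \<open>Poincare disk model of the hyperbolic plane of curvature -1.\<close>

definition hdisk :: "complex set" where
  "hdisk = {z. norm z < 1}"

definition hdist :: "complex \<Rightarrow> complex \<Rightarrow> real" where
  "hdist z w = arcosh (1 + 2 * (norm (z - w))\<^sup>2 / ((1 - (norm z)\<^sup>2) * (1 - (norm w)\<^sup>2)))"

definition hseg :: "complex \<Rightarrow> complex \<Rightarrow> complex set" where
  "hseg z w = {p \<in> hdisk. hdist z p + hdist p w = hdist z w}"

definition hbounded :: "complex set \<Rightarrow> bool" where
  "hbounded A \<longleftrightarrow> (\<exists>c\<in>hdisk. \<exists>R. \<forall>p\<in>A. hdist c p \<le> R)"

text \<open>Relative interior of the Voronoi edge shared by the cells of s and t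
  (empty iff the cells share no Voronoi edge).\<close>
definition voronoi_edge_relint :: "complex set \<Rightarrow> complex \<Rightarrow> complex \<Rightarrow> complex set" where
  "voronoi_edge_relint S s t =
     {p \<in> hdisk. hdist p s = hdist p t \<and> (\<forall>u\<in>S - {s, t}. hdist p s < hdist p u)}"

definition delaunay_adj :: "complex set \<Rightarrow> complex \<Rightarrow> complex \<Rightarrow> bool" where
  "delaunay_adj S s t \<longleftrightarrow> s \<in> S \<and> t \<in> S \<and> s \<noteq> t \<and> voronoi_edge_relint S s t \<noteq> {}"

text \<open>A valid choice of the common points used to draw the Delaunay edges.\<close>
definition delaunay_points :: "complex set \<Rightarrow> (complex \<Rightarrow> complex \<Rightarrow> complex) \<Rightarrow> bool" where
  "delaunay_points S m \<longleftrightarrow>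
     (\<forall>s t. delaunay_adj S s t \<longrightarrow> m s t = m t s \<and> m s t \<in> voronoi_edge_relint S s t)"

definition drawing :: "complex set \<Rightarrow> (complex \<Rightarrow> complex \<Rightarrow> complex) \<Rightarrow> complex set \<Rightarrow> complex set" where
  "drawing S m W = W \<union> (\<Union>s\<in>W. \<Union>t\<in>W. if delaunay_adj S s t then hseg s (m s t) \<union> hseg (m s t) t else {})"

definition outer_face :: "complex set \<Rightarrow> (complex \<Rightarrow> complex \<Rightarrow> complex) \<Rightarrow> complex set \<Rightarrow> complex set" where
  "outer_face S m W = \<Union>{C. \<exists>x \<in> hdisk - drawing S m W.
       C = connected_component_set (hdisk - drawing S m W) x \<and> \<not> hbounded C}"

definition outer_vertices :: "complex set \<Rightarrow> (complex \<Rightarrow> complex \<Rightarrow> complex) \<Rightarrow> complex set \<Rightarrow> complex set" where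
  "outer_vertices S m W = {v \<in> W. v \<in> closure (outer_face S m W)}"

fun k_outerplanar :: "complex set \<Rightarrow> (complex \<Rightarrow> complex \<Rightarrow> complex) \<Rightarrow> nat \<Rightarrow> complex set \<Rightarrow> bool" where
  "k_outerplanar S m 0 W \<longleftrightarrow> W = {}"
| "k_outerplanar S m (Suc k) W \<longleftrightarrow> k_outerplanar S m k (W - outer_vertices S m W)"

end

theory Submission
  imports Defs
begin

text \<open>
A site survives few peeling rounds if a connected unbounded set leads from it to infinity through
the closed Voronoi cells of few sites: the drawing of the remaining graph avoids the cells of the
removed sites, so as long as the set meets the cell of a remaining site, one such cell is met by the
outer face, and its site is joined to the outer face by a geodesic inside the cell.

Such a set is built from geodesic rays. A ray from \<open>s\<close> meets only \<open>O(1 / r)\<close> cells of sites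
within bounded distance of \<open>s\<close> (and only the cell of \<open>s\<close> if \<open>r\<close> is large). When it first reaches
the cell of a more distant site \<open>q\<close>, turn to \<open>q\<close> and restart there. The half-plane of points closer
to \<open>q\<close> than to \<open>s\<close> looks small from \<open>s\<close>, so many different rays lead to disjoint half-planes; moving
into the one with fewest sites divides the number of sites ahead by a factor exponential in the
distance scale, which leaves \<open>1 + O(log n / max 1 r)\<close> stages.
\<close>

section \<open>Hyperboloid coordinates\<close>

text \<open>This is the hyperbolic cosine of the distance, kept free of \<open>arcosh\<close> so
  that comparing distances becomes algebra.\<close>

definition hcosh :: "complex \<Rightarrow> complex \<Rightarrow> real" where
  "hcosh p q = 1 + 2 * (norm (p - q))\<^sup>2 / ((1 - (norm p)\<^sup>2) * (1 - (norm q)\<^sup>2))"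

text \<open>The disk automorphism that carries \<open>s\<close> to the origin.\<close>

definition mob :: "complex \<Rightarrow> complex \<Rightarrow> complex" where
  "mob s z = (z - s) / (1 - cnj s * z)"

text \<open>The spatial part of the hyperboloid coordinates after moving \<open>s\<close> to the
  origin. Its norm is \<open>sinh\<close> of the distance from \<open>s\<close>, and geodesics
  issuing from \<open>s\<close> become straight rays from 0.\<close>

definition chart :: "complex \<Rightarrow> complex \<Rightarrow> complex" where
  "chart s z = (2 / (1 - (norm (mob s z))\<^sup>2)) *\<^sub>R mob s z"

text \<open>The inverse of \<open>chart s\<close>: the rescaled vector is the stereographic
  projection to the disk of the hyperboloid point above \<open>h\<close>, and
  \<open>mob (- s)\<close> undoes the translation.\<close>

definition unchart :: "complex \<Rightarrow> complex \<Rightarrow> complex" where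
  "unchart s h = mob (- s) ((1 / (1 + sqrt (1 + (norm h)\<^sup>2))) *\<^sub>R h)"

lemma hdisk_norm_sq: "p \<in> hdisk \<longleftrightarrow> (norm p)\<^sup>2 < 1"
  by (simp add: hdisk_def power_less_one_iff abs_square_less_1)

lemma zero_hdisk [simp]: "0 \<in> hdisk"
  by (simp add: hdisk_def)

lemma uminus_hdisk [simp]: "- p \<in> hdisk \<longleftrightarrow> p \<in> hdisk"
  by (simp add: hdisk_def)

lemma hcosh_ge_1: "p \<in> hdisk \<Longrightarrow> q \<in> hdisk \<Longrightarrow> 1 \<le> hcosh p q"
  by (simp add: hcosh_def hdisk_norm_sq)

lemma cosh_hdist: "p \<in> hdisk \<Longrightarrow> q \<in> hdisk \<Longrightarrow> cosh (hdist p q) = hcosh p q"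
  using hcosh_ge_1[of p q] by (simp add: hdist_def hcosh_def cosh_arcosh_real)

lemma hdist_nonneg: "p \<in> hdisk \<Longrightarrow> q \<in> hdisk \<Longrightarrow> 0 \<le> hdist p q"
  using hcosh_ge_1[of p q] by (simp add: hdist_def hcosh_def)

lemma hdist_le_iff:
  assumes "p \<in> hdisk" "q \<in> hdisk" "p' \<in> hdisk" "q' \<in> hdisk"
  shows "hdist p q \<le> hdist p' q' \<longleftrightarrow> hcosh p q \<le> hcosh p' q'"
  using assms by (metis cosh_hdist cosh_real_nonneg_le_iff hdist_nonneg)

lemma hdist_commute: "hdist p q = hdist q p"
  by (simp add: hdist_def norm_minus_commute mult.commute)

lemma hcosh_commute: "hcosh p q = hcosh q p"
  by (simp add: hcosh_def norm_minus_commute mult.commute)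

lemma hdist_self [simp]: "hdist p p = 0"
  by (simp add: hdist_def)

lemma hdist_eq_0_iff:
  assumes "p \<in> hdisk" "q \<in> hdisk"
  shows "hdist p q = 0 \<longleftrightarrow> p = q"
proof
  assume "hdist p q = 0"
  then have "hcosh p q = 1" using cosh_hdist[OF assms] by simp
  then show "p = q" using assms by (auto simp: hcosh_def hdisk_norm_sq)
qed auto

lemma mob_denominator: "s \<in> hdisk \<Longrightarrow> z \<in> hdisk \<Longrightarrow> 1 - cnj s * z \<noteq> 0"
proof
  assume a: "s \<in> hdisk" "z \<in> hdisk" "1 - cnj s * z = 0"
  then have "norm (cnj s * z) = 1" by (metis eq_iff_diff_eq_0 norm_one)
  moreover have "norm s * norm z < 1 * 1"
    using a by (intro mult_strict_mono') (auto simp: hdisk_def)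
  ultimately show False by (simp add: norm_mult)
qed

lemma one_minus_norm_mob:
  assumes "s \<in> hdisk" "z \<in> hdisk"
  shows "1 - (norm (mob s z))\<^sup>2
    = (1 - (norm s)\<^sup>2) * (1 - (norm z)\<^sup>2) / (norm (1 - cnj s * z))\<^sup>2"
proof -
  have "(norm (1 - cnj s * z))\<^sup>2 \<noteq> 0" using mob_denominator[OF assms] by simp
  moreover have "(norm (1 - cnj s * z))\<^sup>2 - (norm (z - s))\<^sup>2 = (1 - (norm s)\<^sup>2) * (1 - (norm z)\<^sup>2)"
    unfolding cmod_power2 by (simp add: algebra_simps power2_eq_square)
  ultimately have "1 - (norm (z - s))\<^sup>2 / (norm (1 - cnj s * z))\<^sup>2
      = (1 - (norm s)\<^sup>2) * (1 - (norm z)\<^sup>2) / (norm (1 - cnj s * z))\<^sup>2"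
    by (metis diff_divide_distrib div_self)
  then show ?thesis
    by (simp add: mob_def norm_divide power_divide)
qed

lemma mob_hdisk: "s \<in> hdisk \<Longrightarrow> z \<in> hdisk \<Longrightarrow> mob s z \<in> hdisk"
  using one_minus_norm_mob[of s z] mob_denominator[of s z]
  by (smt (verit) divide_pos_pos hdisk_norm_sq mult_pos_pos zero_less_norm_iff zero_less_power)

lemma mob_mob:
  assumes "s \<in> hdisk" "z \<in> hdisk"
  shows "mob (- s) (mob s z) = z"
proof -
  define D where "D = 1 - cnj s * z"
  have D: "D \<noteq> 0" using mob_denominator[OF assms] by (simp add: D_def)
  have ss: "1 - cnj s * s \<noteq> 0" using mob_denominator[OF assms(1,1)] .
  have "mob s z + s = z * (1 - cnj s * s) / D"
    using D by (simp add: mob_def D_def field_simps)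
  moreover have "1 + cnj s * mob s z = (1 - cnj s * s) / D"
    using D by (simp add: mob_def D_def field_simps)
  ultimately show ?thesis using D ss by (simp add: mob_def[of "- s"])
qed

text \<open>Disk automorphisms are isometries: the factor from \<open>s\<close> and the two Moebius
  denominators occur with equal powers above and below the fraction bar.\<close>

lemma hcosh_mob:
  assumes "s \<in> hdisk" "p \<in> hdisk" "q \<in> hdisk"
  shows "hcosh (mob s p) (mob s q) = hcosh p q"
proof -
  define P Q where "P = 1 - cnj s * p" and "Q = 1 - cnj s * q"
  have nz: "P \<noteq> 0" "Q \<noteq> 0" "(norm s)\<^sup>2 < 1" "(norm p)\<^sup>2 < 1" "(norm q)\<^sup>2 < 1"
    using assms mob_denominator by (auto simp: P_def Q_def hdisk_norm_sq)
  have "mob s p - mob s q = (p - q) * (1 - cnj s * s) / (P * Q)"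
    using nz by (simp add: mob_def P_def Q_def field_simps)
  also have "cnj s * s = of_real ((norm s)\<^sup>2)"
    by (metis complex_norm_square mult.commute)
  also have "1 - complex_of_real ((norm s)\<^sup>2) = of_real (1 - (norm s)\<^sup>2)" by simp
  finally have "norm (mob s p - mob s q) = norm (p - q) * (1 - (norm s)\<^sup>2) / (norm P * norm Q)"
    using nz by (simp add: norm_mult norm_divide del: of_real_diff of_real_power)
  moreover have "1 - (norm (mob s p))\<^sup>2 = (1 - (norm s)\<^sup>2) * (1 - (norm p)\<^sup>2) / (norm P)\<^sup>2"
    "1 - (norm (mob s q))\<^sup>2 = (1 - (norm s)\<^sup>2) * (1 - (norm q)\<^sup>2) / (norm Q)\<^sup>2"
    using one_minus_norm_mob assms by (auto simp: P_def Q_def)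
  moreover have "2 * (d * c / (P' * Q'))\<^sup>2 / ((c * a / P'\<^sup>2) * (c * b / Q'\<^sup>2)) = 2 * d\<^sup>2 / (a * b)"
    if "P' \<noteq> 0" "Q' \<noteq> 0" "c \<noteq> 0" "a \<noteq> 0" "b \<noteq> 0" for P' Q' a b c d :: real
    using that by (simp add: power_divide power_mult_distrib) (simp add: power2_eq_square)
  ultimately show ?thesis
    using nz by (simp add: hcosh_def)
qed

lemma mob_self [simp]: "mob s s = 0"
  by (simp add: mob_def)

lemma hcosh_eq_mob:
  assumes "s \<in> hdisk" "p \<in> hdisk"
  shows "hcosh s p = (1 + (norm (mob s p))\<^sup>2) / (1 - (norm (mob s p))\<^sup>2)"
proof -
  have "hcosh s p = hcosh 0 (mob s p)" using hcosh_mob[of s s p] assms by simp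
  also have "\<dots> = (1 + (norm (mob s p))\<^sup>2) / (1 - (norm (mob s p))\<^sup>2)"
    using mob_hdisk[OF assms] by (simp add: hcosh_def hdisk_norm_sq field_simps)
  finally show ?thesis .
qed

lemma norm_chart_sq:
  assumes "s \<in> hdisk" "p \<in> hdisk"
  shows "(norm (chart s p))\<^sup>2 = (hcosh s p)\<^sup>2 - 1"
  using mob_hdisk[OF assms]
  by (simp add: hcosh_eq_mob[OF assms] chart_def hdisk_norm_sq power_divide field_simps
      power_mult_distrib) (simp add: power2_eq_square algebra_simps)

text \<open>The map \<^term>\<open>\<lambda>p. (hcosh s p, chart s p)\<close> puts \<open>s\<close> at the apex of the hyperboloid model;
  the right-hand side is the Lorentz form there.\<close>
lemma hcosh_chart:
  assumes "s \<in> hdisk" "p \<in> hdisk" "q \<in> hdisk"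
  shows "hcosh p q = hcosh s p * hcosh s q - chart s p \<bullet> chart s q"
proof -
  define a b where "a = mob s p" and "b = mob s q"
  have ab: "(norm a)\<^sup>2 < 1" "(norm b)\<^sup>2 < 1"
    using mob_hdisk assms by (auto simp: a_def b_def hdisk_norm_sq)
  have n: "(norm (a - b))\<^sup>2 = (norm a)\<^sup>2 + (norm b)\<^sup>2 - 2 * (a \<bullet> b)"
    by (simp add: power2_norm_eq_inner inner_diff inner_commute)
  have "hcosh p q = hcosh a b" using hcosh_mob assms by (simp add: a_def b_def)
  also have "\<dots> = (1 + (norm a)\<^sup>2) / (1 - (norm a)\<^sup>2) * ((1 + (norm b)\<^sup>2) / (1 - (norm b)\<^sup>2))
      - (2 / (1 - (norm a)\<^sup>2)) * (2 / (1 - (norm b)\<^sup>2)) * (a \<bullet> b)"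
  proof -
    have "1 + 2 * (x + y - 2 * z) / ((1 - x) * (1 - y))
      = (1 + x) / (1 - x) * ((1 + y) / (1 - y)) - (2 / (1 - x)) * (2 / (1 - y)) * z"
      if "x < 1" "y < 1" for x y z :: real
      using that by (simp add: divide_simps) (simp add: algebra_simps)
    then show ?thesis unfolding hcosh_def n using ab by blast
  qed
  finally show ?thesis
    using assms by (simp add: hcosh_eq_mob chart_def a_def b_def)
qed

lemma sqrt_one_norm_facts:
  fixes h :: complex
  defines "w \<equiv> sqrt (1 + (norm h)\<^sup>2)"
  shows "w \<ge> 1" "(norm h)\<^sup>2 = w\<^sup>2 - 1" "(norm ((1 / (1 + w)) *\<^sub>R h))\<^sup>2 = (w - 1) / (w + 1)"
proof -
  show w: "w \<ge> 1" by (simp add: w_def)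
  show h: "(norm h)\<^sup>2 = w\<^sup>2 - 1" by (simp add: w_def)
  show "(norm ((1 / (1 + w)) *\<^sub>R h))\<^sup>2 = (w - 1) / (w + 1)"
    using w by (simp add: power_divide power_mult_distrib h field_simps)
      (simp add: power2_eq_square algebra_simps)
qed

lemma unchart_aux_hdisk: "(1 / (1 + sqrt (1 + (norm h)\<^sup>2))) *\<^sub>R h \<in> hdisk"
proof -
  define w where "w = sqrt (1 + (norm h)\<^sup>2)"
  have "w \<ge> 1" "(norm ((1 / (1 + w)) *\<^sub>R h))\<^sup>2 = (w - 1) / (w + 1)"
    using sqrt_one_norm_facts[of h] by (auto simp: w_def)
  then show ?thesis by (simp add: hdisk_norm_sq w_def[symmetric])
qed

lemma unchart_hdisk: "s \<in> hdisk \<Longrightarrow> unchart s h \<in> hdisk"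
  unfolding unchart_def using unchart_aux_hdisk by (intro mob_hdisk) auto

lemma chart_unchart:
  assumes "s \<in> hdisk"
  shows "chart s (unchart s h) = h"
proof -
  define w where "w = sqrt (1 + (norm h)\<^sup>2)"
  define a where "a = (1 / (1 + w)) *\<^sub>R h"
  have a: "a \<in> hdisk" using unchart_aux_hdisk by (simp add: a_def w_def)
  have "mob s (unchart s h) = a"
    using mob_mob[of "- s" a] assms a by (simp add: unchart_def a_def w_def)
  moreover have "w \<ge> 1" "(norm a)\<^sup>2 = (w - 1) / (w + 1)"
    using sqrt_one_norm_facts[of h] by (auto simp: a_def w_def)
  ultimately have "chart s (unchart s h) = (2 / (1 - (w - 1) / (w + 1))) *\<^sub>R a"
    by (simp add: chart_def)
  also have "\<dots> = h" using \<open>w \<ge> 1\<close> by (simp add: a_def field_simps)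
  finally show ?thesis .
qed

lemma hcosh_eq_sqrt:
  assumes "s \<in> hdisk" "p \<in> hdisk"
  shows "hcosh s p = sqrt (1 + (norm (chart s p))\<^sup>2)"
  using norm_chart_sq[OF assms] hcosh_ge_1[OF assms] by simp

lemma unchart_chart:
  assumes "s \<in> hdisk" "p \<in> hdisk"
  shows "unchart s (chart s p) = p"
proof -
  define w where "w = hcosh s p"
  define a where "a = mob s p"
  have a: "(norm a)\<^sup>2 < 1" "w = (1 + (norm a)\<^sup>2) / (1 - (norm a)\<^sup>2)"
    using mob_hdisk assms hcosh_eq_mob by (auto simp: a_def w_def hdisk_norm_sq)
  have "(1 / (1 + w)) * (2 / (1 - (norm a)\<^sup>2)) = 1"
    using a(1) unfolding a(2) by (simp add: field_simps)
  then have "(1 / (1 + w)) *\<^sub>R chart s p = a"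
    by (simp add: chart_def a_def)
  then show ?thesis
    using mob_mob[OF assms] by (simp add: unchart_def a_def w_def hcosh_eq_sqrt[OF assms])
qed

lemma continuous_on_unchart:
  assumes "s \<in> hdisk"
  shows "continuous_on UNIV (unchart s)"
proof -
  have 1: "1 + sqrt (1 + (norm h)\<^sup>2) \<noteq> 0" for h :: complex
    by (smt (verit) real_sqrt_ge_zero zero_le_power2)
  have 2: "1 - cnj (- s) * ((1 / (1 + sqrt (1 + (norm h)\<^sup>2))) *\<^sub>R h) \<noteq> 0" for h
    using assms unchart_aux_hdisk by (intro mob_denominator) auto
  show ?thesis unfolding unchart_def mob_def
    by (intro continuous_intros ballI 1 2)
qed

section \<open>Law of cosines, triangle inequality and geodesic segments\<close>

lemma norm_chart:
  assumes "s \<in> hdisk" "p \<in> hdisk"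
  shows "norm (chart s p) = sinh (hdist s p)"
proof -
  have "(norm (chart s p))\<^sup>2 = (sinh (hdist s p))\<^sup>2"
    using norm_chart_sq[OF assms] cosh_hdist[OF assms] cosh_square_eq[of "hdist s p"] by simp
  then show ?thesis using hdist_nonneg[OF assms] by simp
qed

lemma chart_self [simp]: "chart s s = 0"
  by (simp add: chart_def)

lemma chart_inj: "s \<in> hdisk \<Longrightarrow> p \<in> hdisk \<Longrightarrow> q \<in> hdisk \<Longrightarrow> chart s p = chart s q \<Longrightarrow> p = q"
  by (metis unchart_chart)

text \<open>With \<open>y\<close> at the apex, \<open>hcosh_chart\<close> is the law of cosines;
  Cauchy-Schwarz bounds its inner product and leaves the addition formula for
  \<open>cosh\<close>.\<close>

lemma hdist_triangle:
  assumes "x \<in> hdisk" "y \<in> hdisk" "z \<in> hdisk"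
  shows "hdist x z \<le> hdist x y + hdist y z"
proof -
  have "cosh (hdist x z) = cosh (hdist y x) * cosh (hdist y z) - chart y x \<bullet> chart y z"
    using hcosh_chart[of y x z] assms by (simp add: cosh_hdist)
  moreover have "- (chart y x \<bullet> chart y z) \<le> norm (chart y x) * norm (chart y z)"
    using Cauchy_Schwarz_ineq2[of "chart y x" "chart y z"] by linarith
  ultimately have "cosh (hdist x z) \<le> cosh (hdist x y + hdist y z)"
    using assms by (simp add: cosh_add norm_chart hdist_commute[of y x])
  then show ?thesis
    using assms hdist_nonneg by (subst (asm) cosh_real_nonneg_le_iff) auto
qed

text \<open>Equality in the triangle inequality is equality in Cauchy-Schwarz, that is, parallel
  chart vectors. So segments from \<open>s\<close> are radial in the chart at
  \<open>s\<close>.\<close>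

lemma mem_hseg_iff:
  assumes "s \<in> hdisk" "q \<in> hdisk"
  shows "p \<in> hseg s q \<longleftrightarrow> p \<in> hdisk \<and> (\<exists>l. 0 \<le> l \<and> l \<le> 1 \<and> chart s p = l *\<^sub>R chart s q)"
proof (cases "p \<in> hdisk")
  case True
  define a b where "a = hdist s p" and "b = hdist s q"
  have ab: "0 \<le> a" "0 \<le> b" using True assms hdist_nonneg by (auto simp: a_def b_def)
  have n: "norm (chart s p) = sinh a" "norm (chart s q) = sinh b"
    using norm_chart True assms by (auto simp: a_def b_def)
  have c: "cosh (hdist p q) = cosh a * cosh b - chart s p \<bullet> chart s q"
    using hcosh_chart[of s p q] True assms by (simp add: cosh_hdist a_def b_def)
  have "hdist s p + hdist p q = hdist s q \<longleftrightarrow> (\<exists>l. 0 \<le> l \<and> l \<le> 1 \<and> chart s p = l *\<^sub>R chart s q)"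
  proof
    assume eq: "hdist s p + hdist p q = hdist s q"
    then have "hdist p q = b - a" by (simp add: a_def b_def)
    moreover have "0 \<le> hdist p q" using True assms hdist_nonneg by blast
    ultimately have "a \<le> b" and "chart s p \<bullet> chart s q = sinh a * sinh b"
      using c by (auto simp: cosh_diff mult.commute)
    then have "sinh a *\<^sub>R chart s q = sinh b *\<^sub>R chart s p"
      using norm_cauchy_schwarz_eq[of "chart s p" "chart s q"] n by simp
    moreover have "sinh a \<le> sinh b" "0 \<le> sinh a" using \<open>a \<le> b\<close> ab by auto
    moreover have "chart s p = 0" if "sinh b = 0" using that n \<open>sinh a \<le> sinh b\<close> \<open>0 \<le> sinh a\<close> by simp
    ultimately have "chart s p = (sinh a / sinh b) *\<^sub>R chart s q"
      "0 \<le> sinh a / sinh b" "sinh a / sinh b \<le> 1"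
      by (auto simp: eq_vector_fraction_iff divide_le_eq_1)
    then show "\<exists>l. 0 \<le> l \<and> l \<le> 1 \<and> chart s p = l *\<^sub>R chart s q" by blast
  next
    assume "\<exists>l. 0 \<le> l \<and> l \<le> 1 \<and> chart s p = l *\<^sub>R chart s q"
    then obtain l where l: "0 \<le> l" "l \<le> 1" "chart s p = l *\<^sub>R chart s q" by blast
    then have sa: "sinh a = l * sinh b" using n by simp
    then have "sinh a \<le> sinh b" using l ab by (simp add: mult_left_le_one_le)
    then have "a \<le> b" by simp
    have "chart s p \<bullet> chart s q = sinh a * sinh b"
      unfolding l(3) sa using n(2) by (simp add: dot_square_norm power2_eq_square)
    then have "cosh (hdist p q) = cosh (b - a)" using c by (simp add: cosh_diff mult.commute)
    moreover have "0 \<le> hdist p q" using True assms hdist_nonneg by blast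
    ultimately have "hdist p q = b - a" using \<open>a \<le> b\<close>
      by (simp add: cosh_real_nonneg_le_iff order_antisym)
    then show "hdist s p + hdist p q = hdist s q" by (simp add: a_def b_def)
  qed
  then show ?thesis using True by (simp add: hseg_def)
qed (simp add: hseg_def)

lemma hseg_eq_image:
  assumes "s \<in> hdisk" "q \<in> hdisk"
  shows "hseg s q = unchart s ` closed_segment 0 (chart s q)"
proof safe
  fix p assume "p \<in> hseg s q"
  then obtain l where "p \<in> hdisk" "0 \<le> l" "l \<le> 1" "chart s p = l *\<^sub>R chart s q"
    using mem_hseg_iff[OF assms] by blast
  then show "p \<in> unchart s ` closed_segment 0 (chart s q)"
    using unchart_chart[of s p] assms by (intro image_eqI[of _ _ "chart s p"]) (auto simp: in_segment)
next
  fix h assume "h \<in> closed_segment 0 (chart s q)"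
  then show "unchart s h \<in> hseg s q"
    using mem_hseg_iff[OF assms] assms by (auto simp: in_segment unchart_hdisk chart_unchart)
qed

lemma compact_hseg: "s \<in> hdisk \<Longrightarrow> q \<in> hdisk \<Longrightarrow> compact (hseg s q)"
  unfolding hseg_eq_image
  by (intro compact_continuous_image continuous_on_subset[OF continuous_on_unchart]) auto

lemma connected_hseg: "s \<in> hdisk \<Longrightarrow> q \<in> hdisk \<Longrightarrow> connected (hseg s q)"
  unfolding hseg_eq_image
  by (intro connected_continuous_image continuous_on_subset[OF continuous_on_unchart]) auto

lemma hseg_commute: "hseg s q = hseg q s"
  by (auto simp: hseg_def hdist_commute add.commute)

lemma hseg_subset_hdisk: "hseg s q \<subseteq> hdisk"
  by (auto simp: hseg_def)

lemma endpoints_in_hseg: "s \<in> hdisk \<Longrightarrow> q \<in> hdisk \<Longrightarrow> s \<in> hseg s q \<and> q \<in> hseg s q"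
  by (auto simp: hseg_def)

text \<open>Geodesics do not branch: a common point other than \<open>q\<close> fixes the direction
  at \<open>q\<close>, and equal length then fixes the endpoint.\<close>

lemma hseg_unique_extension:
  assumes "q \<in> hdisk" "t \<in> hdisk" "v \<in> hdisk"
    and "x \<in> hseg q t" "x \<in> hseg q v" "x \<noteq> q" "hdist q t = hdist q v"
  shows "t = v"
proof -
  obtain l k where l: "0 \<le> l" "chart q x = l *\<^sub>R chart q t" and k: "0 \<le> k" "chart q x = k *\<^sub>R chart q v"
    using mem_hseg_iff assms by metis
  have x: "x \<in> hdisk" using assms(4) by (simp add: hseg_def)
  then have "chart q x \<noteq> 0" using chart_inj[of q x q] assms by auto
  then have nz: "l \<noteq> 0" "k \<noteq> 0" "chart q t \<noteq> 0" using l k by auto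
  have n: "norm (chart q t) = norm (chart q v)" using norm_chart assms by simp
  have "l * norm (chart q t) = k * norm (chart q v)"
    using l k by (metis abs_of_nonneg norm_scaleR)
  then have "l = k" using n nz by auto
  then have "chart q t = chart q v" using l k nz by simp
  then show ?thesis using chart_inj assms by blast
qed

lemma same_ray_cases:
  assumes "v \<in> hdisk" "q \<in> hdisk" "m \<in> hdisk"
    and "x \<in> hseg v q" "x \<in> hseg v m" "x \<noteq> v"
  shows "q \<in> hseg v m \<or> m \<in> hseg v q"
proof -
  obtain l k where l: "0 \<le> l" "l \<le> 1" "chart v x = l *\<^sub>R chart v q"
    and k: "0 \<le> k" "k \<le> 1" "chart v x = k *\<^sub>R chart v m"
    using mem_hseg_iff assms by metis
  have "chart v x \<noteq> 0" using chart_inj[of v x v] assms by (auto simp: hseg_def)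
  then have "l \<noteq> 0" "k \<noteq> 0" using l(3) k(3) by auto
  then have nz: "l > 0" "k > 0" using l k by auto
  have q: "chart v q = (k / l) *\<^sub>R chart v m"
  proof -
    have "chart v q = (1 / l) *\<^sub>R (l *\<^sub>R chart v q)" using nz by simp
    also have "\<dots> = (1 / l) *\<^sub>R (k *\<^sub>R chart v m)" using l k by simp
    finally show ?thesis by simp
  qed
  have m: "chart v m = (l / k) *\<^sub>R chart v q" unfolding q using nz by simp
  show ?thesis
  proof (cases "k \<le> l")
    case True
    then have "0 \<le> k / l" "k / l \<le> 1" using nz by auto
    then have "q \<in> hseg v m" using mem_hseg_iff[of v m q] assms q by blast
    then show ?thesis ..
  next
    case False
    then have "0 \<le> l / k" "l / k \<le> 1" using nz by auto
    then have "m \<in> hseg v q" using mem_hseg_iff[of v q m] assms m by blast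
    then show ?thesis ..
  qed
qed

section \<open>Bounded sets and geodesic rays\<close>

lemma hbounded_iff:
  assumes "A \<subseteq> hdisk"
  shows "hbounded A \<longleftrightarrow> (\<exists>R. \<forall>p\<in>A. hdist 0 p \<le> R)"
proof
  assume "hbounded A"
  then obtain c R where "c \<in> hdisk" "\<forall>p\<in>A. hdist c p \<le> R" unfolding hbounded_def by blast
  then have "\<forall>p\<in>A. hdist 0 p \<le> hdist 0 c + R"
    using assms hdist_triangle[of 0 c] by force
  then show "\<exists>R. \<forall>p\<in>A. hdist 0 p \<le> R" by blast
qed (use zero_hdisk in \<open>unfold hbounded_def, blast\<close>)

lemma hbounded_Un:
  assumes "A \<subseteq> hdisk" "B \<subseteq> hdisk" "hbounded A" "hbounded B"
  shows "hbounded (A \<union> B)"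
proof -
  obtain R R' where "\<forall>p\<in>A. hdist 0 p \<le> R" "\<forall>p\<in>B. hdist 0 p \<le> R'"
    using assms(3,4) hbounded_iff[OF assms(1)] hbounded_iff[OF assms(2)] by auto
  then have "\<forall>p\<in>A \<union> B. hdist 0 p \<le> max R R'" by fastforce
  then show ?thesis using assms(1,2) by (subst hbounded_iff) auto
qed

lemma hbounded_mono: "hbounded B \<Longrightarrow> A \<subseteq> B \<Longrightarrow> hbounded A"
  unfolding hbounded_def by blast

lemma hbounded_cball:
  assumes "\<rho> < 1" "A \<subseteq> cball 0 \<rho>"
  shows "hbounded A"
proof -
  have A: "A \<subseteq> hdisk" using assms by (force simp: hdisk_def)
  have "hdist 0 p \<le> hdist 0 (of_real \<rho>)" if "p \<in> A" for p
  proof -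
    have p: "norm p \<le> \<rho>" using that assms by auto
    then have \<rho>: "0 \<le> \<rho>" using norm_ge_zero[of p] by linarith
    have sq: "(norm p)\<^sup>2 \<le> \<rho>\<^sup>2" "\<rho>\<^sup>2 < 1" using p \<rho> assms by (auto simp: power_mono abs_square_less_1)
    then have "(norm p)\<^sup>2 / (1 - (norm p)\<^sup>2) \<le> \<rho>\<^sup>2 / (1 - \<rho>\<^sup>2)" by (intro frac_le) auto
    then have "hcosh 0 p \<le> hcosh 0 (of_real \<rho>)" using sq by (simp add: hcosh_def)
    then show ?thesis using that A assms \<rho> by (subst hdist_le_iff) (auto simp: hdisk_def)
  qed
  then show ?thesis using hbounded_iff[OF A] by blast
qed

definition hray :: "complex \<Rightarrow> complex \<Rightarrow> complex set" where
  "hray s e = (\<lambda>t. unchart s (t *\<^sub>R e)) ` {0..}"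

lemma continuous_on_hray: "s \<in> hdisk \<Longrightarrow> continuous_on A (\<lambda>t. unchart s (t *\<^sub>R e))"
  by (intro continuous_on_compose2[OF continuous_on_unchart] continuous_intros) auto

lemma unchart_0: "s \<in> hdisk \<Longrightarrow> unchart s 0 = s"
  by (metis chart_self unchart_chart)

lemma hray_unbounded:
  assumes "s \<in> hdisk" "norm e = 1"
  shows "\<not> hbounded (hray s e)"
proof
  assume "hbounded (hray s e)"
  then obtain c R where c: "c \<in> hdisk" "\<forall>p\<in>hray s e. hdist c p \<le> R" unfolding hbounded_def by blast
  \<comment> \<open>The chart radius \<open>sinh d\<close> belongs to distance \<open>d\<close> from
    \<open>s\<close>; this \<open>d\<close> is too large for a point within \<open>R\<close> of
    \<open>c\<close>.\<close>
  define t where "t = sinh (max 0 (hdist s c + R + 1))"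
  have t: "t \<ge> 0" by (simp add: t_def)
  define p where "p = unchart s (t *\<^sub>R e)"
  have p: "p \<in> hray s e" "p \<in> hdisk" using t assms unchart_hdisk by (auto simp: hray_def p_def)
  have "sinh (hdist s p) = t" using norm_chart[of s p] p assms t by (simp add: p_def chart_unchart)
  then have "hdist s p = max 0 (hdist s c + R + 1)" by (metis sinh_real_eq_iff t_def)
  moreover have "hdist s p \<le> hdist s c + hdist c p" using hdist_triangle assms c p by blast
  ultimately show False using c p by fastforce
qed

lemma hray_subset: "s \<in> hdisk \<Longrightarrow> hray s e \<subseteq> hdisk"
  by (auto simp: hray_def unchart_hdisk)

section \<open>Peeling along escape routes\<close>

text \<open>The closed Voronoi cell: with ties included, the cells of the sites cover the disk and
  are relatively closed, as the connectedness arguments require.\<close>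

definition cell :: "complex set \<Rightarrow> complex \<Rightarrow> complex set" where
  "cell S u = {p \<in> hdisk. \<forall>t\<in>S. hdist p u \<le> hdist p t}"

lemma cell_subset_hdisk: "cell S u \<subseteq> hdisk"
  by (auto simp: cell_def)

text \<open>Comparing two values of \<open>hcosh\<close>, the common factor from \<open>p\<close>
  cancels; clearing the remaining denominators gives polynomial inequalities that make sense on the
  whole plane.\<close>

lemma cell_eq_hdisk_Int_closed:
  assumes "S \<subseteq> hdisk" "u \<in> hdisk"
  obtains K where "closed K" "cell S u = hdisk \<inter> K"
proof
  define K where
    "K = (\<Inter>t\<in>S. {p. (norm (p - u))\<^sup>2 * (1 - (norm t)\<^sup>2) \<le> (norm (p - t))\<^sup>2 * (1 - (norm u)\<^sup>2)})"
  show "closed K" unfolding K_def by (intro closed_INT ballI closed_Collect_le continuous_intros)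
  have "hdist p u \<le> hdist p t \<longleftrightarrow>
      (norm (p - u))\<^sup>2 * (1 - (norm t)\<^sup>2) \<le> (norm (p - t))\<^sup>2 * (1 - (norm u)\<^sup>2)"
    if "p \<in> hdisk" "t \<in> S" for p t
  proof -
    have "t \<in> hdisk" using that assms by blast
    then have "0 < 1 - (norm p)\<^sup>2" "0 < 1 - (norm u)\<^sup>2" "0 < 1 - (norm t)\<^sup>2"
      using that assms by (auto simp: hdisk_norm_sq)
    moreover have "1 + 2 * x / (a * b) \<le> 1 + 2 * y / (a * c) \<longleftrightarrow> x * c \<le> y * b"
      if "0 < a" "0 < b" "0 < c" for a b c x y :: real
      using that by (simp add: field_simps)
    ultimately show ?thesis using that assms \<open>t \<in> hdisk\<close>
      by (simp add: hdist_le_iff hcosh_def)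
  qed
  then show "cell S u = hdisk \<inter> K" by (auto simp: cell_def K_def)
qed

text \<open>Cells are star-shaped about their site: a site nearer to \<open>x\<close> than
  \<open>v\<close> would also be nearer to \<open>q\<close>, by the triangle inequality through
  \<open>x\<close>.\<close>

lemma hseg_subset_cell:
  assumes "S \<subseteq> hdisk" "v \<in> S" "q \<in> cell S v"
  shows "hseg v q \<subseteq> cell S v"
proof
  fix x assume x: "x \<in> hseg v q"
  have q: "q \<in> hdisk" "v \<in> hdisk" using assms by (auto simp: cell_def)
  have "hdist x v \<le> hdist x t" if "t \<in> S" for t
  proof -
    have "hdist q t \<le> hdist q x + hdist x t" "hdist q v \<le> hdist q t"
      using that x q assms hdist_triangle by (auto simp: hseg_def cell_def)
    then show ?thesis using x by (simp add: hseg_def hdist_commute)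
  qed
  then show "x \<in> cell S v" using x by (simp add: hseg_def cell_def)
qed

section \<open>The Delaunay drawing inside the Voronoi cells\<close>

locale delaunay_drawing =
  fixes S :: "complex set" and m :: "complex \<Rightarrow> complex \<Rightarrow> complex"
  assumes finite_sites: "finite S" and sites: "S \<subseteq> hdisk" and points: "delaunay_points S m"
begin

lemma adj_sym: "delaunay_adj S s t \<Longrightarrow> delaunay_adj S t s"
  by (auto simp: delaunay_adj_def voronoi_edge_relint_def insert_commute) metis+

lemma adj_point:
  assumes "delaunay_adj S s t"
  shows "s \<in> S" "t \<in> S" "s \<noteq> t" "s \<in> hdisk" "t \<in> hdisk" "m s t \<in> hdisk" "m t s = m s t"
    "hdist (m s t) s = hdist (m s t) t"
    "\<And>u. u \<in> S \<Longrightarrow> u \<noteq> s \<Longrightarrow> u \<noteq> t \<Longrightarrow> hdist (m s t) s < hdist (m s t) u"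
proof -
  show A: "s \<in> S" "t \<in> S" "s \<noteq> t" using assms by (auto simp: delaunay_adj_def)
  then show "s \<in> hdisk" "t \<in> hdisk" using sites by auto
  have "m s t = m t s \<and> m s t \<in> voronoi_edge_relint S s t"
    using assms points unfolding delaunay_points_def by blast
  then show "m s t \<in> hdisk" "m t s = m s t" "hdist (m s t) s = hdist (m s t) t"
    "\<And>u. u \<in> S \<Longrightarrow> u \<noteq> s \<Longrightarrow> u \<noteq> t \<Longrightarrow> hdist (m s t) s < hdist (m s t) u"
    unfolding voronoi_edge_relint_def by auto
qed

text \<open>Adjacency and the chosen points are symmetric, so the second half of an edge is the
  first half of the reversed edge.\<close>

lemma mem_drawing:
  "x \<in> drawing S m W \<longleftrightarrow>
    x \<in> W \<or> (\<exists>s\<in>W. \<exists>t\<in>W. delaunay_adj S s t \<and> x \<in> hseg s (m s t))"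
proof -
  have "x \<in> hseg (m s t) t \<longleftrightarrow> x \<in> hseg t (m t s)" if "delaunay_adj S s t" for s t
    using adj_point(7)[OF that] hseg_commute by auto
  then show ?thesis using adj_sym unfolding drawing_def by (auto split: if_splits)
qed

text \<open>The triangle inequality through \<open>x\<close> carries the comparison at the edge
  point \<open>m s t\<close> back to \<open>x\<close>. It stays strict for third sites because
  \<open>m s t\<close> is in the relative interior.\<close>

lemma half_edge:
  assumes "delaunay_adj S s t" "x \<in> hseg s (m s t)" "u \<in> S" "u \<noteq> s"
  shows "hdist x s \<le> hdist x u" and "u \<noteq> t \<Longrightarrow> hdist x s < hdist x u"
proof -
  note a = adj_point[OF assms(1)]
  have u: "u \<in> hdisk" using assms sites by blast
  have x: "x \<in> hdisk" "hdist x s + hdist (m s t) x = hdist (m s t) s"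
    using assms(2) by (auto simp: hseg_def hdist_commute)
  have "hdist (m s t) u \<le> hdist (m s t) x + hdist x u"
    using hdist_triangle a(6) x(1) u by blast
  moreover have "hdist (m s t) s \<le> hdist (m s t) u"
    using a(8,9) assms(3,4) by (cases "u = t") (auto simp: less_imp_le)
  moreover have "u \<noteq> t \<Longrightarrow> hdist (m s t) s < hdist (m s t) u"
    using a(9) assms(3,4) by blast
  ultimately show "hdist x s \<le> hdist x u" "u \<noteq> t \<Longrightarrow> hdist x s < hdist x u"
    using x by auto
qed

lemma drawing_Int_other_cell:
  assumes "W \<subseteq> S" "u \<in> S" "u \<notin> W" "x \<in> cell S u"
  shows "x \<notin> drawing S m W"
proof
  assume "x \<in> drawing S m W"
  then consider "x \<in> W" | s t where "s \<in> W" "t \<in> W" "delaunay_adj S s t" "x \<in> hseg s (m s t)"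
    using mem_drawing by blast
  then show False
  proof cases
    case 1
    then have "x \<in> S" using assms by blast
    then have "hdist x u \<le> hdist x x" using assms unfolding cell_def by blast
    moreover have "x \<in> hdisk" "u \<in> hdisk" using 1 assms sites by auto
    ultimately have "x = u" using hdist_nonneg hdist_eq_0_iff by (metis hdist_self order_antisym)
    then show False using 1 assms by blast
  next
    case 2
    then have "hdist x s < hdist x u" using half_edge[of s t x u] assms by blast
    moreover have "hdist x u \<le> hdist x s" using 2 assms by (auto simp: cell_def)
    ultimately show False by simp
  qed
qed

text \<open>A hit \<open>x\<close> would lie on a half-edge at \<open>v\<close>. Since
  \<open>q\<close> is off the drawing, the segment would run through the edge point and beyond it,
  where the neighbour across the edge becomes strictly closer than \<open>v\<close>.\<close>

lemma hseg_Int_drawing: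
  assumes W: "W \<subseteq> S" "v \<in> W" and q: "q \<in> cell S v" "q \<notin> drawing S m W"
    and x: "x \<in> hseg v q" "x \<noteq> v"
  shows "x \<notin> drawing S m W"
proof
  assume "x \<in> drawing S m W"
  have v: "v \<in> S" "v \<in> hdisk" using W sites by auto
  have qd: "q \<in> hdisk" and xd: "x \<in> hdisk" using q x by (auto simp: cell_def hseg_def)
  have xc: "x \<in> cell S v" using hseg_subset_cell[OF sites v(1) q(1)] x by blast
  have "x \<notin> W"
  proof
    assume "x \<in> W"
    then have "x \<in> S" using W by blast
    then have "hdist x v \<le> hdist x x" using xc unfolding cell_def by blast
    then have "x = v" using hdist_nonneg[OF xd v(2)] hdist_eq_0_iff[OF xd v(2)] by simp
    then show False using x by blast
  qed
  then obtain s t where st: "s \<in> W" "t \<in> W" "delaunay_adj S s t" "x \<in> hseg s (m s t)"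
    using \<open>x \<in> drawing S m W\<close> mem_drawing by blast
  note a = adj_point[OF st(3)]
  have xs: "hdist x v \<le> hdist x s" using xc a(1) by (auto simp: cell_def)
  \<comment> \<open>If the half-edge starts at another site, strictness against third sites forces
    \<open>v\<close> to be its other end, and the tie at \<open>x\<close> puts \<open>x\<close> on
    the half-edge from \<open>v\<close> too.\<close>
  have "\<exists>t\<in>W. delaunay_adj S v t \<and> x \<in> hseg v (m v t)"
  proof (cases "v = s")
    case False
    have vt: "v = t"
      using half_edge(2)[OF st(3,4) v(1) False] xs by fastforce
    have "hdist x s = hdist x v" using half_edge(1)[OF st(3,4) v(1) False] xs by simp
    then have "x \<in> hseg v (m s t)"
      using st(4) a(8) vt by (auto simp: hseg_def hdist_commute)
    then show ?thesis using st(1) adj_sym[OF st(3)] vt a(7) by (intro bexI[of _ s]) auto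
  qed (use st in auto)
  then obtain t where t: "t \<in> W" "delaunay_adj S v t" "x \<in> hseg v (m v t)" by blast
  note a = adj_point[OF t(2)]
  have "q \<notin> hseg v (m v t)" using q(2) t(1,2) W mem_drawing by blast
  then have mq: "m v t \<in> hseg v q" using same_ray_cases[OF v(2) qd a(6) x(1) t(3) x(2)] by blast
  have mne: "m v t \<noteq> q" using \<open>q \<notin> hseg v (m v t)\<close> endpoints_in_hseg[OF v(2) a(6)] by auto
  have e1: "hdist q v = hdist q (m v t) + hdist (m v t) t"
    using mq a(8) by (simp add: hseg_def hdist_commute)
  have "hdist q v \<le> hdist q t" using q a(2) by (auto simp: cell_def)
  moreover have "hdist q t \<le> hdist q (m v t) + hdist (m v t) t"
    using hdist_triangle a qd by blast
  ultimately have e2: "hdist q t = hdist q v" "hdist q t = hdist q (m v t) + hdist (m v t) t"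
    using e1 by auto
  \<comment> \<open>Seen from \<open>q\<close>, the segments to \<open>t\<close> and
    \<open>v\<close> have equal length and share the point \<open>m v t\<close>, so unique extension
    applies.\<close>
  have "t = v"
    using hseg_unique_extension[of q t v "m v t"] mq mne e2 qd a hseg_commute[of v q]
    by (simp add: hseg_def)
  then show False using a(3) by simp
qed

lemma compact_drawing:
  assumes "W \<subseteq> S"
  shows "compact (drawing S m W)" "drawing S m W \<subseteq> hdisk"
proof -
  have fin: "finite W" using assms finite_sites finite_subset by blast
  show "compact (drawing S m W)"
    unfolding drawing_def using fin
    by (intro compact_Un compact_UN)
      (auto intro!: compact_Un compact_hseg intro: finite_imp_compact dest: adj_point(4,5,6)
        split: if_split)
  show "drawing S m W \<subseteq> hdisk"
  proof
    fix x assume "x \<in> drawing S m W"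
    then have "x \<in> W \<or> (\<exists>s t. x \<in> hseg s (m s t))" using mem_drawing by blast
    then show "x \<in> hdisk" using assms sites hseg_subset_hdisk by blast
  qed
qed

text \<open>The segment from \<open>v\<close> to \<open>q\<close> without \<open>v\<close> is
  connected and avoids the drawing, so it lies in the component of \<open>q\<close> and accumulates
  at \<open>v\<close>.\<close>

lemma site_in_closure_component:
  assumes W: "W \<subseteq> S" "v \<in> W" and q: "q \<in> cell S v" "q \<in> K"
    and K: "K = connected_component_set (hdisk - drawing S m W) x"
  shows "v \<in> closure K"
proof -
  have v: "v \<in> S" "v \<in> hdisk" using W sites by auto
  have qd: "q \<in> hdisk" "q \<notin> drawing S m W"
    using q K connected_component_subset[of "hdisk - drawing S m W" x] by auto
  define f where "f l = unchart v (l *\<^sub>R chart v q)" for l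
  have cont: "continuous_on A f" for A
    unfolding f_def using continuous_on_hray v by blast
  have f1: "f 1 = q" using unchart_chart v qd by (simp add: f_def)
  have "q \<noteq> v" using qd W mem_drawing by blast
  then have nz: "chart v q \<noteq> 0" using chart_inj[of v q v] v qd by auto
  have out: "f l \<in> hdisk - drawing S m W" if "0 < l" "l \<le> 1" for l
  proof -
    have "chart v (f l) = l *\<^sub>R chart v q" using v by (simp add: f_def chart_unchart)
    then have "f l \<noteq> v" using nz that by auto
    moreover have "f l \<in> hseg v q"
      using that v qd unfolding hseg_eq_image[OF v(2) qd(1)] f_def
      by (intro imageI) (auto simp: in_segment intro!: exI[of _ l])
    ultimately show ?thesis
      using hseg_Int_drawing[OF W q(1) qd(2)] hseg_subset_hdisk by blast
  qed
  have "f ` {0<..1} \<subseteq> connected_component_set (hdisk - drawing S m W) q"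
  proof (rule connected_component_maximal)
    show "q \<in> f ` {0<..1}" using f1 by (intro image_eqI[of _ _ 1]) auto
    show "connected (f ` {0<..1})" by (intro connected_continuous_image cont) auto
    show "f ` {0<..1} \<subseteq> hdisk - drawing S m W" using out by auto
  qed
  also have "\<dots> = K" using q K connected_component_eq by blast
  finally have sub: "f ` {0<..1} \<subseteq> K" .
  have "f ` closure {0<..1} \<subseteq> closure K"
    using closure_mono[OF sub] closure_subset
    by (intro image_closure_subset[OF cont]) (auto intro: closure_subset[THEN subsetD] sub[THEN subsetD])
  moreover have "f 0 = v" using unchart_0 v by (simp add: f_def)
  moreover have "(0::real) \<in> closure {0<..1}" by simp
  ultimately show ?thesis by blast
qed

text \<open>\<open>E\<close> plays the role of an escape route to infinity through the cells of the sites in \<open>T\<close>;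
  each peeling round removes at least one of the remaining sites of \<open>T\<close>.\<close>
definition escape :: "complex set \<Rightarrow> complex set \<Rightarrow> bool" where
  "escape E T \<longleftrightarrow> connected E \<and> E \<subseteq> hdisk \<and> \<not> hbounded E \<and> T \<subseteq> S \<and>
     E \<subseteq> (\<Union>u\<in>T. cell S u) \<and> (\<forall>u\<in>T. cell S u \<inter> E \<noteq> {})"

text \<open>The route enters the unbounded component near infinity. It cannot leave that component
  before meeting the cell of a remaining site, and this site is then on the outer face.\<close>

lemma escape_outer_vertex:
  assumes E: "escape E T" and W: "W \<subseteq> S" "T \<inter> W \<noteq> {}"
  shows "\<exists>v\<in>T \<inter> W. v \<in> outer_vertices S m W"
proof -
  define D where "D = drawing S m W"
  define U where "U = hdisk - D"
  have D: "compact D" "D \<subseteq> hdisk" using compact_drawing W by (auto simp: D_def)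
  have hball: "hdisk = ball 0 1" by (auto simp: hdisk_def)
  have U: "open U" using D by (auto simp: U_def hball compact_imp_closed open_Diff)
  have "W \<subseteq> D" by (auto simp: D_def drawing_def)
  then have "D \<noteq> {}" using W by blast
  obtain \<rho> where \<rho>: "\<rho> < 1" "D \<subseteq> cball 0 \<rho>"
  proof -
    obtain d where d: "d \<in> D" "\<forall>x\<in>D. norm x \<le> norm d"
      using continuous_attains_sup[OF D(1) \<open>D \<noteq> {}\<close> continuous_on_norm_id] by blast
    show thesis using d D by (intro that[of "norm d"]) (auto simp: hdisk_def)
  qed
  \<comment> \<open>Outside a disk containing the compact drawing, what remains is a connected
    annulus. It lies in a single component, which is therefore unbounded, and the unbounded route
    reaches it.\<close>
  define Ann where "Ann = {z::complex. \<rho> < norm z \<and> norm z < 1}"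
  have Ann: "connected Ann" "Ann \<subseteq> U" "hdisk \<subseteq> cball 0 \<rho> \<union> Ann"
    using connected_annulus(1)[of \<rho> "0::complex" 1] \<rho> by (auto simp: Ann_def U_def hdisk_def)
  have "\<not> E \<subseteq> cball 0 \<rho>" using hbounded_cball[OF \<rho>(1)] E unfolding escape_def by blast
  then obtain p where p: "p \<in> E" "p \<in> Ann"
    using E Ann(3) unfolding escape_def by blast
  define K where "K = connected_component_set U p"
  have "p \<in> K" using p Ann unfolding K_def by (simp add: subset_iff)
  have KU: "K \<subseteq> U" using connected_component_subset by (auto simp: K_def)
  have "Ann \<subseteq> K" unfolding K_def using Ann p by (intro connected_component_maximal)
  have "\<not> hbounded K"
  proof
    assume "hbounded K"
    moreover have "K \<subseteq> hdisk" "hdisk \<inter> cball 0 \<rho> \<subseteq> hdisk" using KU U_def by auto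
    ultimately have "hbounded (K \<union> (hdisk \<inter> cball 0 \<rho>))"
      using hbounded_cball[OF \<rho>(1)] by (intro hbounded_Un) auto
    moreover have "hray 0 1 \<subseteq> K \<union> (hdisk \<inter> cball 0 \<rho>)"
      using hray_subset[of 0 1] Ann(3) \<open>Ann \<subseteq> K\<close> by auto
    ultimately show False using hbounded_mono hray_unbounded[of 0 1] by auto
  qed
  then have K_outer: "K \<subseteq> outer_face S m W"
    unfolding outer_face_def using KU \<open>p \<in> K\<close> by (auto simp: K_def U_def D_def)
  \<comment> \<open>Otherwise the part of \<open>E\<close> in \<open>K\<close> is covered by cells
    of removed sites. Their union is relatively closed and avoids the drawing, so this part is
    clopen in \<open>E\<close> and equals \<open>E\<close>; but \<open>E\<close> meets the cell of a
    remaining site.\<close>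
  have "\<exists>v\<in>T \<inter> W. K \<inter> cell S v \<noteq> {}"
  proof (rule ccontr)
    assume none: "\<not> (\<exists>v\<in>T \<inter> W. K \<inter> cell S v \<noteq> {})"
    have "\<forall>u\<in>T. \<exists>C. closed C \<and> cell S u = hdisk \<inter> C"
      using E sites cell_eq_hdisk_Int_closed unfolding escape_def by (metis subsetD)
    then obtain C where C: "\<And>u. u \<in> T \<Longrightarrow> closed (C u) \<and> cell S u = hdisk \<inter> C u" by metis
    define F where "F = (\<Union>u\<in>T - W. C u)"
    have "finite T" using E finite_sites finite_subset unfolding escape_def by blast
    then have F: "closed F" unfolding F_def using C by (intro closed_UN) auto
    have FU: "hdisk \<inter> F \<subseteq> U"
    proof
      fix x assume "x \<in> hdisk \<inter> F"
      then obtain u where "u \<in> T - W" "x \<in> cell S u" using C F_def by auto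
      then show "x \<in> U"
        using drawing_Int_other_cell[OF W(1), of u x] E cell_subset_hdisk
        unfolding escape_def U_def D_def by blast
    qed
    have EKF: "E \<inter> K \<subseteq> F"
    proof
      fix x assume x: "x \<in> E \<inter> K"
      then obtain u where "u \<in> T" "x \<in> cell S u" using E unfolding escape_def by blast
      then show "x \<in> F" using none x C F_def by blast
    qed
    obtain B where B: "closed B" "K = U \<inter> B"
      using closedin_connected_component[of U p] unfolding K_def closedin_closed by blast
    have "E \<inter> K = E \<inter> (F \<inter> B)"
      using EKF B FU E unfolding escape_def by blast
    then have "closedin (top_of_set E) (E \<inter> K)"
      using F B by (simp add: closedin_closed_Int closed_Int)
    moreover have "openin (top_of_set E) (E \<inter> K)"
      using open_connected_component[OF U] by (auto simp: K_def openin_open_Int)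
    ultimately have "E \<inter> K = E"
      using E p \<open>p \<in> K\<close> unfolding escape_def connected_clopen by blast
    moreover obtain v where "v \<in> T \<inter> W" using W by blast
    ultimately show False using none E unfolding escape_def by blast
  qed
  then obtain v q where v: "v \<in> T \<inter> W" "q \<in> K" "q \<in> cell S v" by blast
  have "v \<in> closure K"
    using site_in_closure_component[OF W(1) _ v(3,2)] v(1) by (simp add: K_def U_def D_def)
  then have "v \<in> closure (outer_face S m W)" using closure_mono[OF K_outer] by blast
  then show ?thesis using v(1) by (auto simp: outer_vertices_def)
qed

text \<open>Cells are always those of the full set \<open>S\<close>, so one route serves a site in
  every round, and \<open>card (T \<inter> W)\<close> drops in each round in which some site of
  \<open>T\<close> remains.\<close>

lemma k_outerplanar_if_escape:
  assumes "W \<subseteq> S" "\<And>v. v \<in> W \<Longrightarrow> \<exists>E T. escape E T \<and> v \<in> T \<and> card (T \<inter> W) \<le> k"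
  shows "k_outerplanar S m k W"
  using assms
proof (induction k arbitrary: W)
  case 0
  have "v \<notin> W" for v
  proof
    assume "v \<in> W"
    then obtain T where "v \<in> T" "card (T \<inter> W) = 0" using 0(2) by auto
    moreover have "finite W" using 0(1) finite_sites finite_subset by blast
    ultimately show False using \<open>v \<in> W\<close> by auto
  qed
  then show ?case by auto
next
  case (Suc k)
  define W' where "W' = W - outer_vertices S m W"
  have "k_outerplanar S m k W'"
  proof (rule Suc.IH)
    show "W' \<subseteq> S" using Suc.prems by (auto simp: W'_def)
    fix v assume v: "v \<in> W'"
    then obtain E T where ET: "escape E T" "v \<in> T" "card (T \<inter> W) \<le> Suc k"
      using Suc.prems(2) W'_def by blast
    then obtain w where "w \<in> T \<inter> W" "w \<in> outer_vertices S m W"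
      using escape_outer_vertex[OF ET(1) Suc.prems(1)] v W'_def by blast
    then have "T \<inter> W' \<subset> T \<inter> W" by (auto simp: W'_def)
    moreover have "finite (T \<inter> W)" using Suc.prems(1) finite_sites finite_subset by blast
    ultimately have "card (T \<inter> W') < card (T \<inter> W)" by (rule psubset_card_mono[rotated])
    then show "\<exists>E T. escape E T \<and> v \<in> T \<and> card (T \<inter> W') \<le> k"
      using ET by (intro exI[of _ E] exI[of _ T]) simp
  qed
  then show ?case by (simp add: W'_def)
qed

end

section \<open>Counting cells along a ray\<close>

text \<open>Bins of width \<open>\<delta>\<close> contain at most one value each.\<close>

lemma separated_card:
  fixes f :: "'a \<Rightarrow> real"
  assumes "0 < \<delta>" "\<And>p. p \<in> P \<Longrightarrow> \<bar>f p\<bar> \<le> L"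
    and sep: "\<And>p q. p \<in> P \<Longrightarrow> q \<in> P \<Longrightarrow> p \<noteq> q \<Longrightarrow> \<delta> \<le> \<bar>f p - f q\<bar>"
    and "0 \<le> L"
  shows "real (card P) \<le> 2 * L / \<delta> + 1"
proof -
  define g where "g p = \<lfloor>(f p + L) / \<delta>\<rfloor>" for p
  have "inj_on g P"
  proof (rule inj_onI, rule ccontr)
    fix p q assume pq: "p \<in> P" "q \<in> P" "g p = g q" "p \<noteq> q"
    then have "\<bar>(f p + L) / \<delta> - (f q + L) / \<delta>\<bar> < 1" unfolding g_def by linarith
    then have "\<bar>f p - f q\<bar> < \<delta>" using assms(1)
      by (simp add: diff_divide_distrib[symmetric] abs_divide divide_less_eq)
    then show False using sep[OF pq(1,2,4)] by simp
  qed
  moreover have "g ` P \<subseteq> {0..\<lfloor>2 * L / \<delta>\<rfloor>}"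
  proof (rule image_subsetI)
    fix p assume "p \<in> P"
    then have "0 \<le> f p + L" "f p + L \<le> 2 * L" using assms(2)[of p] by auto
    then show "g p \<in> {0..\<lfloor>2 * L / \<delta>\<rfloor>}" using assms(1)
      by (auto simp: g_def intro!: floor_mono divide_right_mono)
  qed
  ultimately have "card P \<le> card {0..\<lfloor>2 * L / \<delta>\<rfloor>}"
    by (intro card_inj_on_le[of g]) auto
  moreover have "0 \<le> 2 * L / \<delta>" using assms by simp
  ultimately show ?thesis by simp linarith
qed

text \<open>For a point at offset \<open>(- X, C)\<close> from the centre of a circle on the axis, \<open>drift X C\<close>
  decreases along the upper half circle at least as fast as the length of the path in the
  \<open>L\<^sup>1\<close> norm, while it is Lipschitz under moving the centre.\<close>
definition drift :: "real \<Rightarrow> real \<Rightarrow> real" where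
  "drift X C = (if X \<ge> 0 then X - C else X + C - 2 * sqrt (X\<^sup>2 + C\<^sup>2))"

lemma drift_lipschitz:
  assumes "0 \<le> C" "X \<le> X'"
  shows "drift X' C \<le> drift X C + 3 * (X' - X)"
proof -
  have "sqrt (X\<^sup>2 + C\<^sup>2) \<le> sqrt (X'\<^sup>2 + C\<^sup>2) + (X' - X)"
    using real_sqrt_sum_squares_triangle_ineq[of X' "X - X'" C 0] assms
    by (simp add: algebra_simps)
  \<comment> \<open>This bound handles the case \<open>X < 0 \<le> X'\<close>, where the two
    branches of \<open>drift\<close> meet.\<close>
  moreover have "sqrt (X\<^sup>2 + C\<^sup>2) \<le> \<bar>X\<bar> + C"
    using sqrt_sum_squares_le_sum_abs[of X C] assms by simp
  ultimately show ?thesis using assms by (auto simp: drift_def)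
qed

text \<open>On the left quarter circle \<open>C\<close> grows while \<open>X\<close> falls, so
  \<open>X - C\<close> loses both changes; on the right quarter both fall, so \<open>X + C\<close>
  does. Subtracting twice the radius makes the branches agree at the top.\<close>

lemma drift_arc:
  assumes "0 \<le> C" "0 \<le> C'" "X' \<le> X" "X\<^sup>2 + C\<^sup>2 = X'\<^sup>2 + C'\<^sup>2"
  shows "drift X' C' + (X - X') + \<bar>C - C'\<bar> \<le> drift X C"
proof -
  define D where "D = sqrt (X\<^sup>2 + C\<^sup>2)"
  have D': "sqrt (X'\<^sup>2 + C'\<^sup>2) = D" using assms(4) by (simp add: D_def)
  have "C \<le> D" by (simp add: D_def real_le_rsqrt)
  moreover have "C' \<le> D" unfolding D'[symmetric] by (simp add: real_le_rsqrt)
  moreover have "C \<le> C'" if "0 \<le> X'"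
  proof -
    have "X'\<^sup>2 \<le> X\<^sup>2" using that assms by (simp add: power_mono)
    then have "C\<^sup>2 \<le> C'\<^sup>2" using assms(4) by linarith
    then show ?thesis using assms(2) by (rule power2_le_imp_le)
  qed
  moreover have "C' \<le> C" if "X < 0"
  proof -
    have "(- X)\<^sup>2 \<le> (- X')\<^sup>2" using that assms by (intro power_mono) auto
    then have "C'\<^sup>2 \<le> C\<^sup>2" using assms(4) by simp
    then show ?thesis using assms(1) by (rule power2_le_imp_le)
  qed
  ultimately show ?thesis
    using assms(1-3) unfolding drift_def D' D_def[symmetric] by auto
qed

lemma drift_bound: "0 \<le> C \<Longrightarrow> \<bar>drift X C\<bar> \<le> 3 * (\<bar>X\<bar> + C)"
proof -
  assume C: "0 \<le> C"
  define D where "D = sqrt (X\<^sup>2 + C\<^sup>2)"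
  have "0 \<le> D" "D \<le> \<bar>X\<bar> + \<bar>C\<bar>"
    using sqrt_sum_squares_le_sum_abs[of X C] by (auto simp: D_def)
  then show ?thesis using C unfolding drift_def D_def[symmetric] by auto
qed

text \<open>The points of \<open>P\<close> contribute to the lower envelope of the lines \<open>A p - u * B p\<close>.
  Walking along the envelope, the drift relative to the circle through consecutive points with
  centre on the axis pays for the distance between them.\<close>
lemma envelope_card:
  fixes A B C u :: "'a \<Rightarrow> real"
  assumes r: "0 < r" and M: "0 \<le> M"
    and A: "\<And>p. p \<in> P \<Longrightarrow> 1 \<le> A p \<and> A p \<le> M"
    and hyp: "\<And>p. p \<in> P \<Longrightarrow> (A p)\<^sup>2 = 1 + (B p)\<^sup>2 + (C p)\<^sup>2"
    and C: "\<And>p. p \<in> P \<Longrightarrow> 0 \<le> C p"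
    and u: "\<And>p. p \<in> P \<Longrightarrow> 0 \<le> u p \<and> u p \<le> 1"
    and env: "\<And>p q. p \<in> P \<Longrightarrow> q \<in> P \<Longrightarrow> A p - u p * B p \<le> A q - u p * B q"
    and sep: "\<And>p q. p \<in> P \<Longrightarrow> q \<in> P \<Longrightarrow> p \<noteq> q \<Longrightarrow> 4 * r\<^sup>2 \<le> (B p - B q)\<^sup>2 + (C p - C q)\<^sup>2"
  shows "real (card P) \<le> 12 * M / r + 1"
proof -
  \<comment> \<open>Moving the centre by some amount costs at most three times that amount in drift;
    subtracting three times the centre absorbs the cost.\<close>
  define \<Psi> where "\<Psi> p = drift (A p * u p - B p) (C p) - 3 * (A p * u p)" for p
  have step: "\<Psi> q + 2 * r \<le> \<Psi> p" if pq: "p \<in> P" "q \<in> P" "B p < B q" for p q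
  proof -
    \<comment> \<open>The lines of \<open>p\<close> and \<open>q\<close> cross at parameter
      \<open>w\<close>, which the envelope condition places between \<open>u p\<close> and
      \<open>u q\<close>. By \<open>hyp\<close>, \<open>y\<close> is the centre on the axis of the
      circle through both points.\<close>
    define w where "w = (A q - A p) / (B q - B p)"
    define y where "y = w * (A p + A q) / 2"
    have dB: "0 < B q - B p" using pq by simp
    have w1: "u p \<le> w" using env[OF pq(1,2)] dB by (simp add: w_def pos_le_divide_eq algebra_simps)
    have w2: "w \<le> u q" using env[OF pq(2,1)] dB by (simp add: w_def pos_divide_le_eq algebra_simps)
    have w0: "0 \<le> w" using w1 u[OF pq(1)] by simp
    have wB: "w * (B q - B p) = A q - A p" using dB by (simp add: w_def)
    then have Apq: "A p \<le> A q" using w0 dB by (metis diff_ge_0_iff_ge less_imp_le mult_nonneg_nonneg)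
    have "A p * u p \<le> A p * w" using w1 A[OF pq(1)] by (intro mult_left_mono) auto
    also have "\<dots> \<le> y"
      using Apq w0 mult_left_mono[of "A p" "A q" w] by (simp add: y_def algebra_simps)
    finally have y1: "A p * u p \<le> y" .
    have "y \<le> A q * w"
      using Apq w0 mult_left_mono[of "A p" "A q" w] by (simp add: y_def algebra_simps)
    also have "\<dots> \<le> A q * u q" using w2 A[OF pq(2)] by (intro mult_left_mono) auto
    finally have y2: "y \<le> A q * u q" .
    have "2 * y * (B q - B p) = (w * (B q - B p)) * (A p + A q)" by (simp add: y_def)
    also have "\<dots> = (A q)\<^sup>2 - (A p)\<^sup>2" unfolding wB by (simp add: power2_eq_square algebra_simps)
    finally have "(y - B p)\<^sup>2 + (C p)\<^sup>2 = (y - B q)\<^sup>2 + (C q)\<^sup>2"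
      using hyp pq by (simp add: power2_diff algebra_simps)
    then have arc: "drift (y - B q) (C q) + (B q - B p) + \<bar>C p - C q\<bar> \<le> drift (y - B p) (C p)"
      using drift_arc[of "C p" "C q" "y - B q" "y - B p"] C pq by simp
    have "(2 * r)\<^sup>2 \<le> (B q - B p)\<^sup>2 + \<bar>C p - C q\<bar>\<^sup>2"
      using sep[OF pq(1,2)] pq(3) by (auto simp: power2_commute power_mult_distrib)
    also have "\<dots> \<le> ((B q - B p) + \<bar>C p - C q\<bar>)\<^sup>2"
      using dB by (simp add: power2_sum)
    finally have "2 * r \<le> (B q - B p) + \<bar>C p - C q\<bar>"
      by (rule power2_le_imp_le) (use dB in auto)
    moreover have "drift (y - B p) (C p) \<le> drift (A p * u p - B p) (C p) + 3 * (y - A p * u p)"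
      using drift_lipschitz[of "C p" "A p * u p - B p" "y - B p"] C pq y1 by simp
    moreover have "drift (A q * u q - B q) (C q) \<le> drift (y - B q) (C q) + 3 * (A q * u q - y)"
      using drift_lipschitz[of "C q" "y - B q" "A q * u q - B q"] C pq y2 by simp
    ultimately show ?thesis using arc unfolding \<Psi>_def right_diff_distrib by argo
  qed
  \<comment> \<open>When \<open>B\<close> ties, \<open>A\<close> ties by the envelope condition, and
    then \<open>C\<close> up to sign; nonnegativity of \<open>C\<close> would make the points
    coincide.\<close>
  have sep': "2 * r \<le> \<bar>\<Psi> p - \<Psi> q\<bar>" if pq: "p \<in> P" "q \<in> P" "p \<noteq> q" for p q
  proof (cases "B p = B q")
    case True
    then have "A p = A q" using env[OF pq(1,2)] env[OF pq(2,1)] by simp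
    then have "(C p)\<^sup>2 = (C q)\<^sup>2" using hyp[OF pq(1)] hyp[OF pq(2)] True by simp
    then have "C p = C q" using C pq by (simp add: power2_eq_iff_nonneg)
    then show ?thesis using sep[OF pq] True r by simp
  next
    case False
    then show ?thesis using step[of p q] step[of q p] pq r by (cases "B p < B q") auto
  qed
  \<comment> \<open>The centre offset is at most \<open>2 * A p\<close> and the height at most
    \<open>A p\<close>, so the drift contributes \<open>9 * A p\<close> and the correction
    \<open>3 * A p\<close>.\<close>
  have bound: "\<bar>\<Psi> p\<bar> \<le> 12 * M" if p: "p \<in> P" for p
  proof -
    have "(B p)\<^sup>2 \<le> (A p)\<^sup>2" "(C p)\<^sup>2 \<le> (A p)\<^sup>2" using hyp[OF p] by auto
    then have "\<bar>B p\<bar> \<le> A p" "C p \<le> A p"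
      using A[OF p] by (auto simp: abs_le_square_iff[symmetric])
    moreover have "0 \<le> A p * u p" "A p * u p \<le> A p"
      using A[OF p] u[OF p] by (auto intro: mult_left_le)
    ultimately show ?thesis
      using drift_bound[OF C[OF p], of "A p * u p - B p"] conjunct2[OF A[OF p]]
      unfolding \<Psi>_def abs_le_iff by (auto simp: abs_if split: if_splits)
  qed
  have "real (card P) \<le> 2 * (12 * M) / (2 * r) + 1"
    using r M bound sep' by (intro separated_card[of "2 * r" P \<Psi>]) auto
  then show ?thesis by simp
qed

section \<open>From cells along a ray to the envelope\<close>

lemma complex_inner_rotated:
  assumes "norm e = 1"
  shows "h \<bullet> k = (e \<bullet> h) * (e \<bullet> k) + ((\<i> * e) \<bullet> h) * ((\<i> * e) \<bullet> k)"
proof -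
  have "(Re e)\<^sup>2 + (Im e)\<^sup>2 = 1" using assms by (metis cmod_power2 one_power2)
  then have "((Re e)\<^sup>2 + (Im e)\<^sup>2) * (h \<bullet> k) = h \<bullet> k" by simp
  then show ?thesis by (simp add: inner_complex_def power2_eq_square algebra_simps)
qed

lemma hcosh_ge_separation:
  assumes "p \<in> hdisk" "q \<in> hdisk" "0 \<le> r" "2 * r \<le> hdist p q"
  shows "1 + 2 * r\<^sup>2 \<le> hcosh p q"
proof -
  have "r \<le> sinh r" using real_le_x_sinh[of r] assms by (simp add: sinh_def exp_minus)
  then have "r\<^sup>2 \<le> (sinh r)\<^sup>2" using assms by (simp add: power_mono)
  then have "1 + 2 * r\<^sup>2 \<le> cosh (2 * r)" by (simp add: cosh_double cosh_square_eq)
  also have "\<dots> \<le> cosh (hdist p q)" using assms by (simp add: cosh_real_nonneg_le_iff)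
  finally show ?thesis using cosh_hdist assms by simp
qed

text \<open>For \<open>y\<close> on the ray, \<open>hcosh y q\<close> is linear in the coordinates
  \<open>A q\<close> and \<open>B q\<close>. Dividing by \<open>hcosh s y\<close> gives the line
  \<open>A q - u * B q\<close>, so a cell that meets the ray contributes to the lower
  envelope.\<close>

lemma ray_cells_card:
  assumes S: "S \<subseteq> hdisk" "P \<subseteq> S" "finite P" and s: "s \<in> hdisk" and e: "norm e = 1" and r: "0 < r"
    and M: "0 \<le> M" "\<And>p. p \<in> P \<Longrightarrow> hcosh s p \<le> M"
    and sep: "\<And>p q. p \<in> P \<Longrightarrow> q \<in> P \<Longrightarrow> p \<noteq> q \<Longrightarrow> 2 * r \<le> hdist p q"
    and ray: "\<And>p. p \<in> P \<Longrightarrow> cell S p \<inter> hray s e \<noteq> {}"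
  shows "real (card P) \<le> 24 * M / r + 2"
proof -
  define A where "A p = hcosh s p" for p
  define B where "B p = e \<bullet> chart s p" for p
  define C where "C p = (\<i> * e) \<bullet> chart s p" for p
  have Pd: "p \<in> hdisk" if "p \<in> P" for p using that S by blast
  have "\<exists>u. 0 \<le> u \<and> u \<le> 1 \<and> (\<forall>q\<in>P. A p - u * B p \<le> A q - u * B q)" if p: "p \<in> P" for p
  proof -
    obtain t where t: "0 \<le> t" "unchart s (t *\<^sub>R e) \<in> cell S p"
      using ray[OF p] by (auto simp: hray_def)
    define y where "y = unchart s (t *\<^sub>R e)"
    define w where "w = hcosh s y"
    have y: "y \<in> hdisk" "chart s y = t *\<^sub>R e"
      using s by (auto simp: y_def unchart_hdisk chart_unchart)
    have w: "w \<ge> 1" "w\<^sup>2 = 1 + t\<^sup>2"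
      using hcosh_ge_1[OF s y(1)] norm_chart_sq[OF s y(1)] e t by (auto simp: w_def y(2))
    then have "t \<le> w" using power2_le_imp_le[of t w] by simp
    have eq: "hcosh y q = w * A q - t * B q" if "q \<in> hdisk" for q
      using hcosh_chart[OF s y(1) that] by (simp add: w_def A_def B_def y(2))
    have "A p - t / w * B p \<le> A q - t / w * B q" if q: "q \<in> P" for q
    proof -
      have "hcosh y p \<le> hcosh y q"
        using t(2) q S Pd[OF p] Pd[OF q] y(1) hdist_le_iff[of y p y q] by (auto simp: cell_def y_def)
      then have "w * (A p - t / w * B p) \<le> w * (A q - t / w * B q)"
        using eq Pd[OF p] Pd[OF q] w by (simp add: algebra_simps)
      then show ?thesis using w by (simp only: mult_le_cancel_left_pos)
    qed
    then show ?thesis using t w \<open>t \<le> w\<close> by (intro exI[of _ "t / w"]) auto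
  qed
  then obtain u where u: "\<And>p. p \<in> P \<Longrightarrow> 0 \<le> u p \<and> u p \<le> 1"
    "\<And>p q. p \<in> P \<Longrightarrow> q \<in> P \<Longrightarrow> A p - u p * B p \<le> A q - u p * B q"
    by metis
  have A: "1 \<le> A p \<and> A p \<le> M" if "p \<in> P" for p
    using M(2)[OF that] hcosh_ge_1[OF s Pd[OF that]] by (simp add: A_def)
  have hyp: "(A p)\<^sup>2 = 1 + (B p)\<^sup>2 + (C p)\<^sup>2" if "p \<in> P" for p
    using norm_chart_sq[OF s Pd[OF that]] complex_inner_rotated[OF e, of "chart s p" "chart s p"]
    by (simp add: A_def B_def C_def power2_norm_eq_inner) (simp add: power2_eq_square)
  \<comment> \<open>The Lorentz square of the difference of two hyperboloid points is
    \<open>2 * (hcosh p q - 1)\<close>; adding the square of the \<open>A\<close> difference gives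
    the spatial one.\<close>
  have sep': "4 * r\<^sup>2 \<le> (B p - B q)\<^sup>2 + (C p - C q)\<^sup>2" if pq: "p \<in> P" "q \<in> P" "p \<noteq> q" for p q
  proof -
    have "1 + 2 * r\<^sup>2 \<le> A p * A q - (B p * B q + C p * C q)"
      using hcosh_ge_separation[of p q r] sep[OF pq] r Pd pq hcosh_chart[OF s, of p q]
        complex_inner_rotated[OF e, of "chart s p" "chart s q"] by (simp add: A_def B_def C_def)
    moreover have "0 \<le> (A p - A q)\<^sup>2" by simp
    ultimately show ?thesis using hyp[OF pq(1)] hyp[OF pq(2)]
      unfolding power2_diff by linarith
  qed
  \<comment> \<open>The envelope bound needs a sign for \<open>C\<close>, so the two sides of the
    ray are counted separately.\<close>
  define P1 P2 where "P1 = {p \<in> P. 0 \<le> C p}" and "P2 = {p \<in> P. C p < 0}"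
  have "real (card P1) \<le> 12 * M / r + 1"
    using A hyp u sep' r M(1) by (intro envelope_card[of r M P1 A B C u]) (auto simp: P1_def)
  moreover have "real (card P2) \<le> 12 * M / r + 1"
    using A hyp u sep' r M(1)
    by (intro envelope_card[of r M P2 A B "\<lambda>p. - C p" u]) (auto simp: P2_def power2_commute)
  moreover have "P = P1 \<union> P2" by (auto simp: P1_def P2_def)
  then have "card P \<le> card P1 + card P2" using card_Un_le by metis
  ultimately show ?thesis by simp
qed

text \<open>Seen from \<open>s\<close>, the half-plane fits in a narrow cone about the direction of
  \<open>q\<close>. With \<open>b = hdist s q\<close>, the law of cosines bounds the cosine below by
  \<open>(cosh b - 1) / sinh b = tanh (b / 2)\<close>, hence by \<open>1 - 2 * exp (- b)\<close>;
  the squared chord is 2 minus twice the cosine.\<close>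

lemma halfplane_direction:
  assumes d: "s \<in> hdisk" "q \<in> hdisk" "x \<in> hdisk"
    and R: "0 < R" "2 * R \<le> hdist s q" and x: "hdist x q \<le> hdist x s"
  shows "norm (sgn (chart s x) - sgn (chart s q)) \<le> 2 * exp (- R)" and "x \<noteq> s"
proof -
  define a b where "a = hdist s x" and "b = hdist s q"
  show "x \<noteq> s" using x R by auto
  then have ab: "0 < a" "0 < b" "2 * R \<le> b"
    using R hdist_nonneg[OF d(1,3)] hdist_eq_0_iff[OF d(1,3)] by (auto simp: a_def b_def)
  have n: "norm (chart s x) = sinh a" "norm (chart s q) = sinh b"
    using norm_chart d by (auto simp: a_def b_def)
  have "cosh a * cosh b - chart s x \<bullet> chart s q \<le> cosh a"
    using x d hdist_le_iff[of x q x s] hcosh_chart[OF d(1,3,2)] cosh_hdist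
    by (simp add: a_def b_def hcosh_commute[of x s])
  then have "cosh a * (cosh b - 1) \<le> chart s x \<bullet> chart s q" by (simp add: algebra_simps)
  moreover have "sinh a * (cosh b - 1) \<le> cosh a * (cosh b - 1)"
    using cosh_real_ge_1[of b] sinh_less_cosh_real[of a] by (intro mult_right_mono) auto
  ultimately have "sinh a * (cosh b - 1) \<le> chart s x \<bullet> chart s q" by linarith
  then have "(cosh b - 1) / sinh b \<le> (chart s x \<bullet> chart s q) / (sinh a * sinh b)"
    using ab by (simp add: divide_simps mult.commute)
  also have "\<dots> = sgn (chart s x) \<bullet> sgn (chart s q)"
    using n by (simp add: sgn_div_norm divide_simps)
  finally have dot: "(cosh b - 1) / sinh b \<le> sgn (chart s x) \<bullet> sgn (chart s q)" .
  have "(cosh b - 1) - (1 - 2 * exp (- b)) * sinh b = exp (- b) * (1 - exp (- b))"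
    by (simp add: cosh_def sinh_def field_simps exp_minus)
  moreover have "0 \<le> exp (- b) * (1 - exp (- b))" using ab by simp
  ultimately have "(1 - 2 * exp (- b)) * sinh b \<le> cosh b - 1" by linarith
  then have "1 - 2 * exp (- b) \<le> (cosh b - 1) / sinh b" using ab by (simp add: pos_le_divide_eq)
  moreover have "exp (- b) \<le> exp (- R) * exp (- R)" using ab by (simp flip: exp_add)
  ultimately have dot': "1 - 2 * (exp (- R))\<^sup>2 \<le> sgn (chart s x) \<bullet> sgn (chart s q)"
    using dot by (simp add: power2_eq_square)
  have "chart s x \<noteq> 0" "chart s q \<noteq> 0" using n ab by auto
  then have "(norm (sgn (chart s x) - sgn (chart s q)))\<^sup>2 = 2 - 2 * (sgn (chart s x) \<bullet> sgn (chart s q))"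
    using dot_square_norm[of "sgn (chart s x)"] dot_square_norm[of "sgn (chart s q)"]
    by (simp add: power2_norm_eq_inner inner_diff inner_commute norm_sgn)
  also have "\<dots> \<le> (2 * exp (- R))\<^sup>2" using dot' by (simp add: power_mult_distrib)
  finally show "norm (sgn (chart s x) - sgn (chart s q)) \<le> 2 * exp (- R)"
    by (rule power2_le_imp_le) simp
qed

section \<open>Iterating towards fewer sites\<close>

lemma nearest_site:
  assumes "finite S" "S \<noteq> {}" "x \<in> hdisk"
  obtains p where "p \<in> S" "x \<in> cell S p"
proof -
  obtain p where "p \<in> S" "\<forall>t\<in>S. hdist x p \<le> hdist x t"
    using arg_min_if_finite[OF assms(1,2), of "hdist x"] by (metis linorder_not_le)
  then show thesis using that assms by (auto simp: cell_def)
qed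

context delaunay_drawing
begin

definition ray_sites :: "real \<Rightarrow> complex \<Rightarrow> complex \<Rightarrow> complex set" where
  "ray_sites R s e = {p \<in> S. hdist s p < 2 * R \<and> cell S p \<inter> hray s e \<noteq> {}}"

lemma ray_sites_self:
  assumes "s \<in> S" "0 < R"
  shows "s \<in> hray s e" "s \<in> cell S s" "s \<in> ray_sites R s e"
proof -
  have d: "s \<in> hdisk" using assms sites by blast
  show 1: "s \<in> hray s e" using unchart_0[OF d] unfolding hray_def by (intro image_eqI[of _ _ 0]) auto
  show "s \<in> cell S s" using d sites hdist_nonneg by (auto simp: cell_def)
  then show "s \<in> ray_sites R s e" using assms 1 by (auto simp: ray_sites_def)
qed

text \<open>\<open>E\<close> follows the ray until it first reaches the cell of a site \<open>q\<close> far from \<open>s\<close>, and then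
  turns to \<open>q\<close>.\<close>
definition stage ::
  "real \<Rightarrow> complex \<Rightarrow> complex \<Rightarrow> complex \<Rightarrow> complex set \<Rightarrow> complex set \<Rightarrow> bool" where
  "stage R s e q E T \<longleftrightarrow>
    q \<in> S \<and> 2 * R \<le> hdist s q \<and> connected E \<and> E \<subseteq> hdisk \<and> s \<in> E \<and> q \<in> E \<and>
    s \<in> T \<and> T \<subseteq> ray_sites R s e \<and> E \<subseteq> (\<Union>u\<in>insert q T. cell S u) \<and>
    (\<forall>u\<in>T. cell S u \<inter> E \<noteq> {}) \<and> (\<exists>y\<in>hray s e. hdist y q \<le> hdist y s)"

lemma escape_or_stage:
  assumes s: "s \<in> S" and e: "norm e = 1" and R: "0 < R"
  shows "escape (hray s e) (ray_sites R s e) \<or> (\<exists>q E T. stage R s e q E T)"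
proof -
  have d: "s \<in> hdisk" using s sites by blast
  define f where "f t = unchart s (t *\<^sub>R e)" for t
  have fd: "f t \<in> hdisk" for t using d by (simp add: f_def unchart_hdisk)
  have cont: "continuous_on A f" for A unfolding f_def using continuous_on_hray[OF d] .
  have near: "\<exists>p\<in>S. f t \<in> cell S p" for t
    using nearest_site[OF finite_sites _ fd] s by blast
  define Q where "Q = {q \<in> S. 2 * R \<le> hdist s q}"
  \<comment> \<open>The times at which the ray is in the cell of a far site. If there are none, the
    ray itself is an escape route; otherwise closedness provides a first such time.\<close>
  define Z where "Z = {t. 0 \<le> t \<and> (\<exists>q\<in>Q. f t \<in> cell S q)}"
  show ?thesis
  proof (cases "Z = {}")
    case True
    have "hray s e \<subseteq> (\<Union>u\<in>ray_sites R s e. cell S u)"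
    proof
      fix y assume y: "y \<in> hray s e"
      then obtain t where t: "0 \<le> t" "y = f t" by (auto simp: hray_def f_def)
      then obtain p where p: "p \<in> S" "y \<in> cell S p" using near by blast
      then have "hdist s p < 2 * R" using True t by (force simp: Z_def Q_def)
      then show "y \<in> (\<Union>u\<in>ray_sites R s e. cell S u)" using p y by (auto simp: ray_sites_def)
    qed
    moreover have "connected (hray s e)"
      using cont unfolding hray_def f_def by (intro connected_continuous_image) auto
    ultimately have "escape (hray s e) (ray_sites R s e)"
      using hray_unbounded[OF d e] hray_subset[OF d] by (auto simp: escape_def ray_sites_def)
    then show ?thesis ..
  next
    case False
    have "\<forall>q\<in>Q. \<exists>C. closed C \<and> cell S q = hdisk \<inter> C"
      using sites cell_eq_hdisk_Int_closed unfolding Q_def by (metis (no_types, lifting) mem_Collect_eq subsetD)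
    then obtain C where C: "\<And>q. q \<in> Q \<Longrightarrow> closed (C q) \<and> cell S q = hdisk \<inter> C q" by metis
    have "Z = {0..} \<inter> f -` (\<Union>q\<in>Q. C q)" using C fd by (auto simp: Z_def)
    moreover have "closed (\<Union>q\<in>Q. C q)" using C finite_sites by (intro closed_UN) (auto simp: Q_def)
    ultimately have "closed Z"
      using continuous_closed_preimage[OF cont, of "{0..}" "\<Union>q\<in>Q. C q"] by simp
    moreover have bdd: "bdd_below Z" by (intro bdd_belowI[of _ 0]) (auto simp: Z_def)
    ultimately have "Inf Z \<in> Z" using False closed_contains_Inf by blast
    define \<tau> where "\<tau> = Inf Z"
    have \<tau>: "0 \<le> \<tau>" "\<And>t. t \<in> Z \<Longrightarrow> \<tau> \<le> t"
      using \<open>Inf Z \<in> Z\<close> cInf_lower[OF _ bdd] unfolding \<tau>_def by (simp_all add: Z_def)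
    obtain q where q: "q \<in> S" "2 * R \<le> hdist s q" "f \<tau> \<in> cell S q"
      using \<open>Inf Z \<in> Z\<close> by (auto simp: \<tau>_def Z_def Q_def)
    have qd: "q \<in> hdisk" using q sites by blast
    define G where "G = f ` {0..\<tau>}"
    have G: "G \<subseteq> hray s e" "G \<subseteq> hdisk" "s \<in> G" "f \<tau> \<in> G" "connected G"
    proof -
      show "connected G" unfolding G_def by (intro connected_continuous_image cont) auto
      have "f 0 = s" using unchart_0[OF d] by (simp add: f_def)
      then show "s \<in> G" using \<tau> unfolding G_def by (intro image_eqI[of _ _ 0]) auto
    qed (use \<tau> fd in \<open>auto simp: G_def hray_def f_def\<close>)
    \<comment> \<open>Only cells met up to the turn are collected, so each of them meets
      \<open>E\<close>; the final segment is covered by the star-shaped cell of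
      \<open>q\<close>.\<close>
    define T where "T = {p \<in> S. hdist s p < 2 * R \<and> cell S p \<inter> G \<noteq> {}}"
    define E where "E = G \<union> hseg q (f \<tau>)"
    have ends: "q \<in> hseg q (f \<tau>)" "f \<tau> \<in> hseg q (f \<tau>)" using endpoints_in_hseg[OF qd fd] by auto
    have "connected E"
      unfolding E_def using G ends connected_hseg[OF qd fd] by (intro connected_Un) auto
    moreover have "E \<subseteq> hdisk" using G hseg_subset_hdisk by (auto simp: E_def)
    moreover have "E \<subseteq> (\<Union>u\<in>insert q T. cell S u)"
    proof
      fix y assume "y \<in> E"
      then consider "y \<in> hseg q (f \<tau>)" | t where "0 \<le> t" "t \<le> \<tau>" "y = f t"
        by (auto simp: E_def G_def)
      then show "y \<in> (\<Union>u\<in>insert q T. cell S u)"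
      proof cases
        case 1
        then show ?thesis using hseg_subset_cell[OF sites q(1,3)] by blast
      next
        case 2
        show ?thesis
        proof (cases "t = \<tau>")
          case False
          obtain p where p: "p \<in> S" "y \<in> cell S p" using near 2 by blast
          have "t \<notin> Z" using False 2 \<tau>(2)[of t] by auto
          then have "hdist s p < 2 * R" using 2 p by (force simp: Z_def Q_def)
          then have "p \<in> T" using p 2 by (auto simp: T_def G_def)
          then show ?thesis using p by blast
        qed (use 2 q in auto)
      qed
    qed
    moreover have "T \<subseteq> ray_sites R s e" using G(1) by (auto simp: T_def ray_sites_def)
    moreover have "s \<in> T" using s G(3) ray_sites_self(2)[OF s R] R by (auto simp: T_def)
    moreover have "\<forall>u\<in>T. cell S u \<inter> E \<noteq> {}" by (auto simp: T_def E_def)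
    moreover have "hdist (f \<tau>) q \<le> hdist (f \<tau>) s" using q(3) s by (auto simp: cell_def)
    then have "\<exists>y\<in>hray s e. hdist y q \<le> hdist y s" using G(1,4) by blast
    moreover have "s \<in> E" "q \<in> E" using G ends by (auto simp: E_def)
    ultimately have "stage R s e q E T" using q unfolding stage_def by blast
    then show ?thesis by blast
  qed
qed

definition halfplane_sites :: "complex \<Rightarrow> complex \<Rightarrow> complex set" where
  "halfplane_sites s q = {p \<in> S. hdist p q \<le> hdist p s}"

text \<open>Both \<open>y\<close> and \<open>p\<close> lie in the half-plane of \<open>q\<close>, so
  their directions are each within \<open>2 * exp (- R)\<close> of that of \<open>q\<close>, and
  \<open>y\<close> has direction \<open>e\<close>.\<close>

lemma halfplane_sites_near_ray:
  assumes s: "s \<in> S" and q: "q \<in> S" and R: "0 < R" "2 * R \<le> hdist s q" and e: "norm e = 1"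
    and y: "y \<in> hray s e" "hdist y q \<le> hdist y s" and p: "p \<in> halfplane_sites s q"
  shows "norm (sgn (chart s p) - e) \<le> 4 * exp (- R)"
proof -
  have d: "s \<in> hdisk" "q \<in> hdisk" "p \<in> hdisk" "y \<in> hdisk"
    using s q p y sites hray_subset[of s e] by (auto simp: halfplane_sites_def)
  obtain t where t: "0 \<le> t" "y = unchart s (t *\<^sub>R e)" using y by (auto simp: hray_def)
  have yn: "y \<noteq> s" "norm (sgn (chart s y) - sgn (chart s q)) \<le> 2 * exp (- R)"
    using halfplane_direction[OF d(1,2,4) R y(2)] by auto
  have cy: "chart s y = t *\<^sub>R e" using t d by (simp add: chart_unchart)
  then have "t \<noteq> 0" using yn(1) chart_inj[of s y s] d by auto
  then have "sgn (chart s y) = e" using t(1) e unfolding cy sgn_scaleR by (simp add: sgn_div_norm)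
  moreover have "norm (sgn (chart s p) - sgn (chart s q)) \<le> 2 * exp (- R)"
    using halfplane_direction[OF d(1,2,3) R] p by (auto simp: halfplane_sites_def)
  ultimately show ?thesis
    using yn(2) norm_triangle_ineq4[of "sgn (chart s p) - sgn (chart s q)" "e - sgn (chart s q)"] by simp
qed

text \<open>Each stage shoots \<open>l + 1\<close> rays that are so far apart that the half-planes they lead to are
  pairwise disjoint and at most one of them leaves the current half-plane, so that some half-plane
  contains at most the fraction \<open>1 / l\<close> of the current sites.\<close>
lemma escape_from_halfplane:
  fixes l k0 :: nat
  assumes R: "0 < R" and l: "1 \<le> l" "12 * exp (- R) < 1 / real l"
    and k0: "\<And>s e. s \<in> S \<Longrightarrow> norm e = 1 \<Longrightarrow> card (ray_sites R s e) \<le> k0"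
  shows "s \<in> S \<Longrightarrow> X = S \<or> (\<exists>a\<in>S. 2 * R \<le> hdist s a \<and> X = halfplane_sites a s) \<Longrightarrow>
    card X < l ^ j \<Longrightarrow> \<exists>E T. escape E T \<and> s \<in> T \<and> s \<in> E \<and> card T \<le> k0 * j"
proof (induction j arbitrary: s X)
  \<comment> \<open>Here \<open>card X < 1\<close>, although \<open>s\<close> itself belongs to
    \<open>X\<close>.\<close>
  case 0
  have sd: "s \<in> hdisk" using 0 sites by blast
  have "s \<in> X" using 0 sites sd hdist_nonneg by (auto simp: halfplane_sites_def)
  moreover have "finite X" using 0(2) finite_sites by (auto simp: halfplane_sites_def)
  ultimately show ?case using 0(3) by auto
next
  case (Suc j)
  note s = Suc.prems(1)
  have sd: "s \<in> hdisk" using s sites by blast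
  \<comment> \<open>These \<open>l + 1\<close> unit vectors have real parts spaced
    \<open>1 / l\<close> apart, which exceeds \<open>12 * exp (- R)\<close>.\<close>
  define e where "e i = Complex (real i / real l) (sqrt (1 - (real i / real l)\<^sup>2))" for i :: nat
  have e: "norm (e i) = 1" if "i \<le> l" for i
  proof -
    have "0 \<le> real i / real l" "real i / real l \<le> 1" using that l by auto
    then have "(real i / real l)\<^sup>2 \<le> 1" by (simp add: power_le_one)
    then show ?thesis by (simp add: e_def cmod_def)
  qed
  have far: "12 * exp (- R) < norm (e i - e i')" if "i \<noteq> i'" for i i'
  proof -
    have "1 \<le> \<bar>real i - real i'\<bar>" using that by linarith
    then have "1 / real l \<le> \<bar>real i - real i'\<bar> / real l" using l by (intro divide_right_mono) auto
    also have "\<dots> = \<bar>Re (e i - e i')\<bar>" using l by (simp add: e_def diff_divide_distrib[symmetric] abs_divide)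
    also have "\<dots> \<le> norm (e i - e i')" by (rule abs_Re_le_cmod)
    finally show ?thesis using l by linarith
  qed
  show ?case
  proof (cases "\<exists>i\<le>l. escape (hray s (e i)) (ray_sites R s (e i))")
    case True
    then obtain i where i: "i \<le> l" "escape (hray s (e i)) (ray_sites R s (e i))" by blast
    have "card (ray_sites R s (e i)) \<le> k0 * Suc j" using k0[OF s e[OF i(1)]] by simp
    then show ?thesis using i ray_sites_self[OF s R] by blast
  next
    case False
    have "\<exists>q E T. stage R s (e i) q E T" if "i \<le> l" for i
      using False escape_or_stage[OF s e[OF that] R] that by blast
    then obtain q E T where "\<And>i. i \<le> l \<Longrightarrow> stage R s (e i) (q i) (E i) (T i)" by metis
    note stage = this[unfolded stage_def]
    define Y where "Y i = halfplane_sites s (q i)" for i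
    have dir: "norm (sgn (chart s p) - e i) \<le> 4 * exp (- R)" if "i \<le> l" "p \<in> Y i" for i p
      using halfplane_sites_near_ray[OF s _ R _ e[OF that(1)]] stage[OF that(1)] that(2)
      unfolding Y_def by blast
    have disj: "Y i \<inter> Y i' = {}" if "i \<le> l" "i' \<le> l" "i \<noteq> i'" for i i'
    proof (rule ccontr)
      assume "Y i \<inter> Y i' \<noteq> {}"
      then obtain p where "p \<in> Y i" "p \<in> Y i'" by blast
      then have "norm (e i - e i') \<le> 8 * exp (- R)"
        using dir[of i p] dir[of i' p] that(1,2)
          norm_triangle_ineq4[of "sgn (chart s p) - e i'" "sgn (chart s p) - e i"] by simp
      then show False using far[OF that(3)] by (smt (verit) exp_gt_zero)
    qed
    define G where "G = {i. i \<le> l \<and> Y i \<subseteq> X}"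
    \<comment> \<open>A site of \<open>Y i\<close> outside \<open>X\<close> is closer to
      \<open>a\<close> than to \<open>s\<close>, so \<open>e i\<close> is within
      \<open>4 + 2 = 6\<close> times \<open>exp (- R)\<close> of the direction of \<open>a\<close>.
      Two such rays would be within \<open>12 * exp (- R)\<close>.\<close>
    have bad: "i = i'" if i: "i \<le> l" "\<not> Y i \<subseteq> X" and i': "i' \<le> l" "\<not> Y i' \<subseteq> X" for i i'
    proof (rule ccontr)
      assume ne: "i \<noteq> i'"
      have "X \<noteq> S" using i by (auto simp: Y_def halfplane_sites_def)
      then obtain a where a: "a \<in> S" "2 * R \<le> hdist s a" "X = halfplane_sites a s"
        using Suc.prems(2) by blast
      have ad: "a \<in> hdisk" using a sites by blast
      have near: "norm (e i - sgn (chart s a)) \<le> 6 * exp (- R)" if i: "i \<le> l" "\<not> Y i \<subseteq> X" for i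
      proof -
        obtain p where p: "p \<in> Y i" "p \<notin> X" using i by blast
        have pS: "p \<in> S" "p \<in> hdisk" using p sites by (auto simp: Y_def halfplane_sites_def)
        then have "hdist p a \<le> hdist p s" using p(2) a(3) by (auto simp: halfplane_sites_def)
        then have "norm (sgn (chart s p) - sgn (chart s a)) \<le> 2 * exp (- R)"
          using halfplane_direction(1)[OF sd ad pS(2) R a(2)] by blast
        then show ?thesis
          using dir[OF i(1) p(1)]
            norm_triangle_ineq4[of "sgn (chart s p) - sgn (chart s a)" "sgn (chart s p) - e i"] by simp
      qed
      have "norm (e i - e i') \<le> 12 * exp (- R)"
        using near[OF i] near[OF i']
          norm_triangle_ineq4[of "e i - sgn (chart s a)" "e i' - sgn (chart s a)"] by simp
      then show False using far[OF ne] by simp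
    qed
    have "l \<le> card G"
    proof -
      have "\<forall>i\<in>{..l} - G. \<forall>i'\<in>{..l} - G. i = i'" using bad by (simp add: G_def)
      then have "card ({..l} - G) \<le> Suc 0" by (simp add: card_le_Suc0_iff_eq)
      moreover have "card {..l} \<le> card G + card ({..l} - G)"
        using card_Un_le[of G "{..l} - G"] by (simp add: Un_absorb1 G_def subset_iff Un_Diff_cancel)
      ultimately show ?thesis by simp
    qed
    have finX: "finite X" using Suc.prems(2) finite_sites by (auto simp: halfplane_sites_def)
    \<comment> \<open>Pigeonhole: at least \<open>l\<close> disjoint sets lie inside
      \<open>X\<close>, which has fewer than \<open>l * l ^ j\<close> elements.\<close>
    have "\<exists>i\<in>G. card (Y i) < l ^ j"
    proof (rule ccontr)
      assume "\<not> (\<exists>i\<in>G. card (Y i) < l ^ j)"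
      then have "card G * l ^ j \<le> (\<Sum>i\<in>G. card (Y i))"
        using sum_bounded_below[of G "l ^ j" "\<lambda>i. card (Y i)"] by (simp add: not_less)
      also have "\<dots> = card (\<Union>i\<in>G. Y i)"
        using disj finite_sites
        by (intro card_UN_disjoint[symmetric]) (auto simp: G_def Y_def halfplane_sites_def)
      also have "\<dots> \<le> card X" using finX by (intro card_mono) (auto simp: G_def)
      also have "\<dots> < l * l ^ j" using Suc.prems(3) by simp
      finally have "card G * l ^ j < l * l ^ j" .
      moreover have "l * l ^ j \<le> card G * l ^ j" using \<open>l \<le> card G\<close> by (rule mult_right_mono) simp
      ultimately show False by linarith
    qed
    then obtain i where i: "i \<le> l" "card (Y i) < l ^ j" by (auto simp: G_def)
    note st = stage[OF i(1)]
    \<comment> \<open>The invariant for the next stage: seen from \<open>q i\<close>, the current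
      site \<open>s\<close> plays the role of \<open>a\<close>.\<close>
    have "\<exists>a\<in>S. 2 * R \<le> hdist (q i) a \<and> Y i = halfplane_sites a (q i)"
      using st s by (intro bexI[of _ s]) (auto simp: Y_def hdist_commute)
    then obtain E' T' where ET': "escape E' T'" "q i \<in> T'" "q i \<in> E'" "card T' \<le> k0 * j"
      using Suc.IH[of "q i" "Y i"] st i by blast
    \<comment> \<open>The pieces meet at \<open>q i\<close>, whose cell the stage uses without
      counting it; \<open>T'\<close> counts it.\<close>
    have "escape (E i \<union> E') (T i \<union> T')"
      unfolding escape_def
    proof (intro conjI)
      show "connected (E i \<union> E')" using st ET' by (intro connected_Un) (auto simp: escape_def)
      show "\<not> hbounded (E i \<union> E')"
        using ET'(1) hbounded_mono unfolding escape_def by blast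
      show "T i \<union> T' \<subseteq> S" using st ET'(1) by (auto simp: escape_def ray_sites_def)
      show "E i \<union> E' \<subseteq> (\<Union>u\<in>T i \<union> T'. cell S u)" using st ET'(1,2) unfolding escape_def by blast
      show "\<forall>u\<in>T i \<union> T'. cell S u \<inter> (E i \<union> E') \<noteq> {}" using st ET'(1) unfolding escape_def by blast
    qed (use st ET'(1) in \<open>auto simp: escape_def\<close>)
    moreover have "card (T i \<union> T') \<le> k0 * Suc j"
    proof -
      have "finite (ray_sites R s (e i))" using finite_sites by (simp add: ray_sites_def)
      then have "card (T i) \<le> k0" using st k0[OF s e[OF i(1)]] card_mono le_trans by meson
      then show ?thesis using card_Un_le[of "T i" T'] ET'(4) by simp
    qed
    ultimately show ?thesis using st by blast
  qed
qed

section \<open>Choice of scales and constants\<close>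

lemma outerplanar_bound:
  assumes R: "6 \<le> R" and n: "1 \<le> card S"
    and k0: "\<And>s e. s \<in> S \<Longrightarrow> norm e = 1 \<Longrightarrow> card (ray_sites R s e) \<le> k0"
  shows "\<exists>j. k_outerplanar S m (k0 * j) S \<and> real j \<le> 1 + 4 * ln (card S) / R"
proof -
  \<comment> \<open>About \<open>exp (R / 2)\<close> rays per stage: few enough to be separated
    beyond \<open>12 * exp (- R)\<close>, and enough for \<open>ln l \<ge> R / 4\<close>.\<close>
  define l where "l = nat \<lfloor>exp (R / 2)\<rfloor>"
  have quarter: "5 / 2 \<le> exp (R / 4)"
    using exp_ge_add_one_self[of "R / 4"] R by linarith
  have sq: "exp (R / 2) = exp (R / 4) * exp (R / 4)" by (simp flip: exp_add)
  have "exp (R / 4) + 1 \<le> exp (R / 4) * (5 / 2)" using quarter by linarith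
  also have "\<dots> \<le> exp (R / 2)" unfolding sq using quarter by (intro mult_left_mono) auto
  finally have ge: "exp (R / 4) + 1 \<le> exp (R / 2)" .
  then have "0 < exp (R / 2) - 1" by (smt (verit) exp_gt_zero)
  then have lr: "real l \<le> exp (R / 2)" "exp (R / 4) \<le> real l"
    using ge unfolding l_def by linarith+
  have l2: "2 \<le> l" using quarter lr by linarith
  \<comment> \<open>Separation needs \<open>exp (R / 2) > 12\<close>; \<open>R \<ge> 6\<close>
    reduces this to a lower bound for \<open>exp 3\<close>.\<close>
  have "12 < (5 / 4 :: real) ^ 12" by (simp add: power_divide)
  also have "\<dots> \<le> exp (1 / 4) ^ 12"
    using exp_ge_add_one_self[of "1 / 4 :: real"] by (intro power_mono) auto
  also have "\<dots> = exp 3" by (simp flip: exp_of_nat_mult)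
  also have "\<dots> \<le> exp (R / 2)" using R by simp
  finally have "12 < exp (R / 2)" .
  then have "12 * exp (- R) < exp (R / 2) * exp (- R)" by simp
  also have "\<dots> = 1 / exp (R / 2)" by (simp add: exp_minus field_simps flip: exp_add)
  also have "\<dots> \<le> 1 / real l" using lr l2 by (intro divide_left_mono) auto
  finally have sep: "12 * exp (- R) < 1 / real l" .
  have "ln (exp (R / 4)) \<le> ln (real l)" using lr l2 by (subst ln_le_cancel_iff) auto
  then have lnl: "R / 4 \<le> ln (real l)" by simp
  \<comment> \<open>This is the logarithm of \<open>card S\<close> to base \<open>l\<close>; the
    integer \<open>j\<close> just above it gives \<open>card S < l ^ j\<close>.\<close>
  define x where "x = ln (real (card S)) / ln (real l)"
  define j where "j = nat \<lfloor>x\<rfloor> + 1"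
  have "0 \<le> ln (real (card S))" using n by simp
  then have x0: "0 \<le> x" using l2 by (simp add: x_def)
  have "x \<le> ln (real (card S)) / (R / 4)"
    unfolding x_def using lnl R \<open>0 \<le> ln (real (card S))\<close> by (intro divide_left_mono) auto
  then have jle: "real j \<le> 1 + 4 * ln (card S) / R" 
  proof -
    have "real j \<le> 1 + x" using x0 unfolding j_def by linarith
    then show ?thesis using \<open>x \<le> ln (real (card S)) / (R / 4)\<close> by (simp add: mult.commute)
  qed
  have "x < real j" using x0 unfolding j_def by linarith
  then have "ln (real (card S)) < real j * ln (real l)" using l2 by (simp add: x_def divide_less_eq)
  also have "\<dots> = ln (real (l ^ j))" using l2 by (simp add: ln_realpow)
  finally have "card S < l ^ j" using n l2 by (subst (asm) ln_less_cancel_iff) (auto simp flip: of_nat_power)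
  then have "k_outerplanar S m (k0 * j) S"
  proof (intro k_outerplanar_if_escape)
    fix v assume "v \<in> S"
    then obtain E T where "escape E T" "v \<in> T" "card T \<le> k0 * j"
      using escape_from_halfplane[OF _ _ sep k0, of v S j] R l2 \<open>card S < l ^ j\<close> by fastforce
    moreover have "T \<inter> S = T" using \<open>escape E T\<close> by (auto simp: escape_def)
    ultimately show "\<exists>E T. escape E T \<and> v \<in> T \<and> card (T \<inter> S) \<le> k0 * j"
      by (intro exI[of _ E] exI[of _ T]) simp
  qed auto
  then show ?thesis using jle by blast
qed

text \<open>For \<open>r \<ge> 6\<close> the scale \<open>R = r\<close> leaves one near site per
  ray. For smaller \<open>r\<close> the scale is fixed at 6, each stage costs
  \<open>O(1 / r)\<close> cells, and with at least two sites \<open>ln (card S)\<close> absorbs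
  additive constants. A single site joins the first case, since its logarithm is 0 and the bound
  must be exactly 1.\<close>

lemma outerplanar_bound_separated:
  assumes r: "0 < r" and n: "1 \<le> card S"
    and sep: "\<And>s t. s \<in> S \<Longrightarrow> t \<in> S \<Longrightarrow> s \<noteq> t \<Longrightarrow> 2 * r \<le> hdist s t"
  shows "\<exists>k. k_outerplanar S m k S \<and> real k \<le> 1 + (72 * cosh 12 + 36) * ln (card S) / r"
proof (cases "6 \<le> r \<or> card S = 1")
  case True
  define R where "R = max r 6"
  have "ray_sites R s e \<subseteq> {s}" if "s \<in> S" for s e
    using True
  proof
    assume "6 \<le> r"
    then have "R = r" by (simp add: R_def)
    then show ?thesis using sep that by (fastforce simp: ray_sites_def)
  next
    assume "card S = 1"
    then have "S = {s}" using that by (auto simp: card_Suc_eq dest!: card_1_singletonE)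
    then show ?thesis unfolding ray_sites_def by blast
  qed
  then have "card (ray_sites R s e) \<le> 1" if "s \<in> S" for s e
    using card_mono[of "{s}"] that by fastforce
  then obtain j where j: "k_outerplanar S m (1 * j) S" "real j \<le> 1 + 4 * ln (card S) / R"
    using outerplanar_bound[of R 1] n by (auto simp: R_def)
  have "0 \<le> ln (real (card S))" using n by simp
  then have "4 * ln (card S) / R \<le> (72 * cosh 12 + 36) * ln (card S) / r"
    using r cosh_real_ge_1[of 12] by (intro frac_le mult_right_mono) (auto simp: R_def)
  then show ?thesis using j by (intro exI[of _ j]) auto
next
  case False
  \<comment> \<open>Near sites are within \<open>2 * 6 = 12\<close>, so their \<open>hcosh\<close>
    values are at most \<open>cosh 12\<close>.\<close>
  define M :: real where "M = cosh 12"
  have M: "1 \<le> M" by (simp add: M_def cosh_real_ge_1)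
  define k0 where "k0 = nat \<lfloor>24 * M / r + 2\<rfloor>"
  have pos: "0 \<le> 24 * M / r + 2" using M r by simp
  have k0: "card (ray_sites 6 s e) \<le> k0" if se: "s \<in> S" "norm e = 1" for s e
  proof -
    have sd: "s \<in> hdisk" using se sites by blast
    have "hcosh s p \<le> M" if "p \<in> ray_sites 6 s e" for p
    proof -
      have p: "p \<in> hdisk" "hdist s p < 12" using that sites by (auto simp: ray_sites_def)
      then have "cosh (hdist s p) \<le> cosh 12"
        using hdist_nonneg[OF sd p(1)] by (simp add: cosh_real_nonneg_le_iff)
      then show ?thesis using cosh_hdist[OF sd p(1)] by (simp add: M_def)
    qed
    then have "real (card (ray_sites 6 s e)) \<le> 24 * M / r + 2"
      using sites finite_sites sd se r sep M
      by (intro ray_cells_card[of S _ s e]) (auto simp: ray_sites_def)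
    then show ?thesis using pos unfolding k0_def by linarith
  qed
  obtain j where j: "k_outerplanar S m (k0 * j) S" "real j \<le> 1 + 4 * ln (card S) / 6"
    using outerplanar_bound[of 6 k0] n k0 by auto
  have r6: "r < 6" and n2: "2 \<le> card S" using False n by auto
  have "(2::real) / 3 \<le> ln 2" by (rule ln2_ge_two_thirds)
  also have "\<dots> \<le> ln (card S)" using n2 by simp
  finally have lnS: "2 / 3 \<le> ln (real (card S))" .
  have "real k0 \<le> 24 * M / r + 2" using pos unfolding k0_def by linarith
  \<comment> \<open>Since \<open>r < 6\<close>, the constant 2 is at most
    \<open>12 / r\<close>.\<close>
  also have "\<dots> \<le> 24 * M / r + 12 / r" using r r6 by (simp add: field_simps)
  finally have "real k0 \<le> (24 * M + 12) / r" by (simp add: add_divide_distrib)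
  moreover have "real j \<le> 3 * ln (card S)" using j(2) lnS by linarith
  ultimately have "real k0 * real j \<le> (24 * M + 12) / r * (3 * ln (card S))"
    using M r by (intro mult_mono) auto
  also have "\<dots> = (72 * M + 36) * ln (card S) / r" by (simp add: field_simps)
  finally show ?thesis using j(1) by (intro exI[of _ "k0 * j"]) (auto simp: M_def)
qed

end

theorem theorem4:
  "\<exists>C > 0. \<forall>(r::real) (S::complex set) (n::nat) m.
     r > 0 \<and> finite S \<and> card S = n \<and> n \<ge> 1 \<and> S \<subseteq> hdisk \<and>
     (\<forall>s\<in>S. \<forall>t\<in>S. s \<noteq> t \<longrightarrow> hdist s t \<ge> 2 * r) \<and>
     delaunay_points S m
     \<longrightarrow> (\<exists>k::nat. k_outerplanar S m k S \<and> real k \<le> 1 + C * ln (real n) / r)"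
proof (intro exI[of _ "72 * cosh 12 + 36"] conjI allI impI)
  show "(0::real) < 72 * cosh 12 + 36" using cosh_real_pos[of 12] by linarith
next
  fix r :: real and S :: "complex set" and n :: nat and m
  assume a: "r > 0 \<and> finite S \<and> card S = n \<and> n \<ge> 1 \<and> S \<subseteq> hdisk \<and>
     (\<forall>s\<in>S. \<forall>t\<in>S. s \<noteq> t \<longrightarrow> hdist s t \<ge> 2 * r) \<and> delaunay_points S m"
  then interpret delaunay_drawing S m by unfold_locales auto
  show "\<exists>k::nat. k_outerplanar S m k S \<and> real k \<le> 1 + (72 * cosh 12 + 36) * ln (real n) / r"
    using outerplanar_bound_separated[of r] a by auto
qed

end
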